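(* Let $G$ be a graph of maximum degree $\Delta$ and let $\mathcal{U}$ be a $(2\Delta)$-thick partition of $V(G)$ for which $\mathcal{G} = (G,\mathcal{U})$ is irreducible. If $G$ is not a disjoint union of $|\mathcal{U}|$ copies of the complete bipartite graph $K_{\Delta,\Delta}$, then the reconfigurability graph of $\mathcal{G}$ is connected.
   Context: Graphs are finite and simple. Let $G$ be a graph and $\mathcal{U}$ a partition of $V(G)$ (its members are called blocks). The partition is $t$-thick if $|U|\ge t$ for every $U\in\mathcal{U}$. An independent transversal of $\mathcal{G}=(G,\mathcal{U})$ is an independent set $S$ of $G$ with $|S\cap U|=1$ for all $U\in\mathcal{U}$; $\operatorname{IT}(\mathcal{G})$ denotes the set of independent transversals of $\mathcal{G}$. The reconfigurability graph of $\mathcal{G}$ has vertex set $\operatorname{IT}(\mathcal{G})$, with $S$ and $T$ adjacent if and only if $S\cup T$ is an independent set of $G$ of size $|\mathcal{U}|+1$ (i.e. $S$ and $T$ agree on all but one block, and on that block their respective vertices are distinct and not adjacent in $G$). The union of two graph-partition pairs is $(G_1,\mathcal{U}_1)\cup(G_2,\mathcal{U}_2)=(G_1\sqcup G_2,\mathcal{U}_1\cup\mathcal{U}_2)$, where $\sqcup$ is disjoint graph union. A pair $\mathcal{G}$ is irreducible if it cannot be written as $\mathcal{G}_1\cup\mathcal{G}_2$ with $\mathcal{G}_1,\mathcal{G}_2$ both nontrivial (each having at least one block). *)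

theory Defs
  imports "Graph_Theory.Kuratowski" "HOL-Library.Disjoint_Sets"
begin

text \<open>
  A finite simple graph is a \<^locale>\<open>pair_graph\<close>: a finite loopless digraph whose arc set is a
  symmetric set of ordered pairs, so that an edge \<open>uv\<close> is the pair of arcs \<open>(u, v)\<close>, \<open>(v, u)\<close>.
\<close>

definition graph_partition :: "'a pair_pre_digraph \<Rightarrow> 'a set set \<Rightarrow> bool" where
  "graph_partition G \<U> \<longleftrightarrow> pair_graph G \<and> partition_on (pverts G) \<U>"

text \<open>
  In a symmetric digraph the out-degree of a vertex is its degree as a vertex of the undirected
  graph. The inserted 0 only matters for the graph without vertices.
\<close>
definition max_degree :: "'a pair_pre_digraph \<Rightarrow> nat" where
  "max_degree G = Max (insert 0 (out_degree (with_proj G) ` pverts G))"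

definition thick :: "nat \<Rightarrow> 'a set set \<Rightarrow> bool" where
  "thick t \<U> \<longleftrightarrow> (\<forall>B\<in>\<U>. t \<le> card B)"

definition independent_set :: "'a pair_pre_digraph \<Rightarrow> 'a set \<Rightarrow> bool" where
  "independent_set G S \<longleftrightarrow> S \<subseteq> pverts G \<and> (\<forall>u\<in>S. \<forall>v\<in>S. (u, v) \<notin> parcs G)"

definition IT :: "'a pair_pre_digraph \<Rightarrow> 'a set set \<Rightarrow> 'a set set" where
  "IT G \<U> = {S. independent_set G S \<and> (\<forall>B\<in>\<U>. card (S \<inter> B) = 1)}"

definition reconfigurability_graph ::
  "'a pair_pre_digraph \<Rightarrow> 'a set set \<Rightarrow> 'a set pair_pre_digraph" where
  "reconfigurability_graph G \<U> =
     \<lparr> pverts = IT G \<U>,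
       parcs = {(S, T). S \<in> IT G \<U> \<and> T \<in> IT G \<U> \<and>
                        independent_set G (S \<union> T) \<and> card (S \<union> T) = card \<U> + 1} \<rparr>"

definition is_disjoint_union ::
  "'a pair_pre_digraph \<Rightarrow> 'i set \<Rightarrow> ('i \<Rightarrow> 'a pair_pre_digraph) \<Rightarrow> bool" where
  "is_disjoint_union G I H \<longleftrightarrow>
     disjoint_family_on (\<lambda>i. pverts (H i)) I \<and>
     pverts G = (\<Union>i\<in>I. pverts (H i)) \<and> parcs G = (\<Union>i\<in>I. parcs (H i))"

definition is_union_of_pairs ::
  "'a pair_pre_digraph \<Rightarrow> 'a set set \<Rightarrow> 'a pair_pre_digraph \<Rightarrow> 'a set set \<Rightarrow>
   'a pair_pre_digraph \<Rightarrow> 'a set set \<Rightarrow> bool" where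
  "is_union_of_pairs G \<U> G1 \<U>1 G2 \<U>2 \<longleftrightarrow>
     pverts G1 \<inter> pverts G2 = {} \<and>
     pverts G = pverts G1 \<union> pverts G2 \<and> parcs G = parcs G1 \<union> parcs G2 \<and>
     \<U> = \<U>1 \<union> \<U>2"

definition irreducible_pair :: "'a pair_pre_digraph \<Rightarrow> 'a set set \<Rightarrow> bool" where
  "irreducible_pair G \<U> \<longleftrightarrow>
     \<not> (\<exists>G1 \<U>1 G2 \<U>2. graph_partition G1 \<U>1 \<and> graph_partition G2 \<U>2 \<and>
          \<U>1 \<noteq> {} \<and> \<U>2 \<noteq> {} \<and> is_union_of_pairs G \<U> G1 \<U>1 G2 \<U>2)"

definition disjoint_union_of_K :: "nat \<Rightarrow> nat \<Rightarrow> 'a pair_pre_digraph \<Rightarrow> bool" where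
  "disjoint_union_of_K k d G \<longleftrightarrow>
     (\<exists>H :: nat \<Rightarrow> 'a pair_pre_digraph.
        (\<forall>i<k. complete_bipartite_digraph d d (with_proj (H i))) \<and>
        is_disjoint_union G {..<k} H)"

end

theory Submission
  imports Defs
begin

text \<open>
  A transversal is treated as a choice function on the blocks. Haxell's argument, run with swaps
  that are reconfiguration moves, either finds a vertex \<open>w\<close> in a prescribed family of blocks with no
  neighbour among the current choices, or a family of \<open>k\<close> blocks that is totally dominated by \<open>2k\<close>
  vertices.

  Let \<open>S\<close>, \<open>T\<close> be disconnected from each other. Started from the blocks on which they differ, the
  first outcome lets them agree more often, so the second one holds for a set \<open>X\<close>. Thickness
  \<open>2\<Delta>\<close> leaves no slack: every vertex of the \<open>k\<close> blocks has exactly one neighbour in \<open>X\<close>, and \<open>X\<close>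
  induces a perfect matching that links the blocks in a connected unicyclic way; the edges on which
  \<open>S\<close> and \<open>T\<close> choose different ends form the cycle. Take \<open>k\<close> maximal. For a cycle edge \<open>zz'\<close> and any
  neighbour \<open>v\<close> of \<open>z\<close>, exchanging \<open>z'\<close> for \<open>v\<close> and rerouting \<open>S\<close> gives another such \<open>X\<close>, so
  \<open>v\<close> and \<open>z'\<close> have the same neighbours. Hence every vertex that is ever on a cycle lies in a
  component \<open>K\<^bsub>\<Delta>,\<Delta>\<^esub>\<close>. The set of blocks whose choice under \<open>S\<close> is such a vertex does not change under
  these exchanges, and counting shows that these components fill these blocks completely.
  Irreducibility then forces them to be all blocks.
\<close>

subsection \<open>Haxell swaps\<close>

locale block_graph =
  fixes E :: "'a \<Rightarrow> 'a \<Rightarrow> bool"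
  assumes sym: "E x y \<Longrightarrow> E y x"
    and irrefl: "\<not> E x x"
begin

definition transversal :: "'a set set \<Rightarrow> ('a set \<Rightarrow> 'a) \<Rightarrow> bool" where
  "transversal P f \<longleftrightarrow> (\<forall>C\<in>P. f C \<in> C) \<and> (\<forall>B\<in>P. \<forall>C\<in>P. \<not> E (f B) (f C))"

text \<open>\<open>A\<close> holds vertices that are already committed: a newly chosen vertex must
  be nonadjacent to all of them. The condition \<open>\<not> E (f C) w\<close> makes the change a
  reconfiguration move. The trivial move \<open>w = f C\<close> is not excluded.\<close>

definition step :: "'a set set \<Rightarrow> 'a set \<Rightarrow> ('a set \<Rightarrow> 'a) \<Rightarrow> ('a set \<Rightarrow> 'a) \<Rightarrow> bool" where
  "step P A f g \<longleftrightarrow> transversal P f \<and> transversal P g \<and>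
     (\<exists>C\<in>P. \<exists>w. g = f(C := w) \<and> \<not> E (f C) w \<and> (\<forall>a\<in>A. \<not> E a w))"

definition override :: "'a set set \<Rightarrow> ('a set \<Rightarrow> 'a) \<Rightarrow> ('a set \<Rightarrow> 'a) \<Rightarrow> ('a set \<Rightarrow> 'a)" where
  "override P g f = (\<lambda>C. if C \<in> P then g C else f C)"

lemma override_simps [simp]:
  "C \<in> P \<Longrightarrow> override P g f C = g C"
  "C \<notin> P \<Longrightarrow> override P g f C = f C"
  by (simp_all add: override_def)

lemma transversalI:
  assumes "\<And>C. C \<in> P \<Longrightarrow> f C \<in> C" "\<And>B C. B \<in> P \<Longrightarrow> C \<in> P \<Longrightarrow> \<not> E (f B) (f C)"
  shows "transversal P f"
  using assms by (auto simp: transversal_def)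

lemma transversal_in: "transversal P f \<Longrightarrow> C \<in> P \<Longrightarrow> f C \<in> C"
  and transversal_indep: "transversal P f \<Longrightarrow> B \<in> P \<Longrightarrow> C \<in> P \<Longrightarrow> \<not> E (f B) (f C)"
  by (auto simp: transversal_def)

lemma transversal_subset: "transversal P f \<Longrightarrow> Q \<subseteq> P \<Longrightarrow> transversal Q f"
  by (auto simp: transversal_def)

lemma stepI:
  assumes "transversal P f" "C \<in> P" "w \<in> C" "\<And>a. a \<in> A \<Longrightarrow> \<not> E a w"
    "\<And>B. B \<in> P \<Longrightarrow> \<not> E w (f B)"
  shows "step P A f (f(C := w))" "transversal P (f(C := w))"
proof -
  show t: "transversal P (f(C := w))"
    using assms sym irrefl by (auto simp: transversal_def)
  show "step P A f (f(C := w))"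
    unfolding step_def using assms t sym by blast
qed

lemma steps_transversal: "(step P A)\<^sup>*\<^sup>* f g \<Longrightarrow> transversal P f \<Longrightarrow> transversal P g"
  by (induction rule: rtranclp_induct) (auto simp: step_def)

lemma steps_avoid:
  assumes "(step P A)\<^sup>*\<^sup>* f g" "\<And>a C. a \<in> A \<Longrightarrow> C \<in> P \<Longrightarrow> \<not> E a (f C)" "a \<in> A" "C \<in> P"
  shows "\<not> E a (g C)"
  using assms(1)
proof (induction rule: rtranclp_induct)
  case base
  then show ?case using assms by blast
next
  case (step y z)
  then show ?case using assms(3,4) by (auto simp: step_def split: if_splits)
qed

lemma lift_steps:
  assumes st: "(step P1 A1)\<^sup>*\<^sup>* f g" and sub: "P1 \<subseteq> P"
    and agree: "\<And>C. C \<in> P1 \<Longrightarrow> S C = f C"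
    and tr: "transversal P S"
    and avoid: "\<And>C B w. C \<in> P - P1 \<Longrightarrow> B \<in> P1 \<Longrightarrow> w \<in> B \<Longrightarrow> (\<And>a. a \<in> A1 \<Longrightarrow> \<not> E a w) \<Longrightarrow> \<not> E (S C) w"
    and A: "A \<subseteq> A1"
  shows "(step P A)\<^sup>*\<^sup>* S (override P1 g S) \<and> transversal P (override P1 g S)"
  using st
proof (induction rule: rtranclp_induct)
  case base
  have "override P1 f S = S" using agree by (auto simp: override_def)
  then show ?case using tr by simp
next
  case (step g h)
  from step.hyps(2) obtain C w where C: "C \<in> P1" "h = g(C := w)" "\<not> E (g C) w" "\<And>a. a \<in> A1 \<Longrightarrow> \<not> E a w"
    and tg: "transversal P1 g" and th: "transversal P1 h" by (auto simp: step_def)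
  have wC: "w \<in> C" using transversal_in[OF th C(1)] C(2) by simp
  have eq: "override P1 h S = (override P1 g S)(C := w)"
    using C by (auto simp: override_def fun_eq_iff)
  have "\<not> E w (override P1 g S B)" if "B \<in> P" for B
  proof (cases "B \<in> P1")
    case True
    show ?thesis
    proof (cases "B = C")
      case True
      then show ?thesis using C sym by auto
    next
      case False
      then show ?thesis using transversal_indep[OF th C(1) True] C(2) True by simp
    qed
  next
    case False
    then show ?thesis using avoid[of B C w] that C wC sym by auto
  qed
  then have "step P A (override P1 g S) (override P1 h S)" "transversal P (override P1 h S)"
    unfolding eq using stepI[of P "override P1 g S" C w A] step.IH C(1) sub wC C(4) A by blast+
  then show ?case using step.IH by auto
qed

section \<open>A free vertex or a small total domination\<close>

definition free_vertex :: "'a set set \<Rightarrow> 'a set \<Rightarrow> 'a set set \<Rightarrow> ('a set \<Rightarrow> 'a) \<Rightarrow> bool" where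
  "free_vertex P A D g \<longleftrightarrow> (\<exists>w\<in>\<Union>D. (\<forall>a\<in>A. \<not> E w a) \<and> (\<forall>C\<in>P. \<not> E w (g C)))"

text \<open>The last conjunct says that the blocks of \<open>Q\<close> are reached from \<open>D\<close> through edges from \<open>W\<close>
  to the current choices; it makes the dominating set cut-connected later.\<close>
definition dominated ::
  "'a set \<Rightarrow> 'a set set \<Rightarrow> ('a set \<Rightarrow> 'a) \<Rightarrow> 'a set set \<Rightarrow> 'a set \<Rightarrow> bool" where
  "dominated A D g Q W \<longleftrightarrow> finite W \<and> W \<subseteq> \<Union>(D \<union> Q) \<and> card W \<le> card Q \<and>
     (\<forall>v\<in>\<Union>(D \<union> Q). \<exists>x\<in>A \<union> W \<union> g ` Q. E v x) \<and>
     (\<forall>\<C>. D \<subseteq> \<C> \<longrightarrow> \<not> Q \<subseteq> \<C> \<longrightarrow> (\<exists>w\<in>W \<inter> \<Union>\<C>. \<exists>C\<in>Q - \<C>. E w (g C)))"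

text \<open>Two nested inductions: the outer one on the number of blocks, the inner one on the
  number of choices adjacent to a fixed \<open>w\<close> in \<open>\<Union>D\<close> that avoids
  \<open>A\<close>. The blocks \<open>Q0\<close> of these choices are frozen, and the outer
  hypothesis is applied to the other blocks with target blocks \<open>D \<union> Q0\<close>. A free
  vertex in \<open>\<Union>D\<close> finishes; one in a block of \<open>Q0\<close> permits a move
  that lowers the inner measure; a domination is extended by \<open>w\<close> and
  \<open>Q0\<close>.\<close>

lemma haxell_swap:
  assumes "finite P" "transversal P f" "\<And>a C. a \<in> A \<Longrightarrow> C \<in> P \<Longrightarrow> \<not> E a (f C)"
  shows "\<exists>g. (step P A)\<^sup>*\<^sup>* f g \<and> (free_vertex P A D g \<or> (\<exists>Q\<subseteq>P. \<exists>W. dominated A D g Q W))"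
  using assms
proof (induction "card P" arbitrary: P A D f rule: less_induct)
  case (less P A D f)
  note outer_IH = less.hyps
  show ?case
  proof (cases "\<exists>w\<in>\<Union>D. \<forall>a\<in>A. \<not> E w a")
    case False
    then have "dominated A D f {} {}" by (auto simp: dominated_def)
    then show ?thesis by blast
  next
    case True
    then obtain w where w: "w \<in> \<Union>D" "\<forall>a\<in>A. \<not> E w a" by blast
    show ?thesis using less.prems(2,3)
    proof (induction "card {C \<in> P. E w (f C)}" arbitrary: f rule: less_induct)
      case (less f)
      note tf = \<open>transversal P f\<close> and Af = less.prems(2)
      define Q0 where "Q0 = {C \<in> P. E w (f C)}"
      show ?case
      proof (cases "Q0 = {}")
        case True
        then have "free_vertex P A D f" using w by (auto simp: Q0_def free_vertex_def)
        then show ?thesis by blast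
      next
        case False
        define P1 where "P1 = P - Q0"
        \<comment> \<open>Moves avoiding \<open>A1\<close> stay compatible with the choices frozen
          on \<open>Q0\<close> and create no new conflict with \<open>w\<close>.\<close>
        define A1 where "A1 = A \<union> {w} \<union> f ` Q0"
        have Q0P: "Q0 \<subseteq> P" by (auto simp: Q0_def)
        have P: "P = P1 \<union> Q0" "P1 \<inter> Q0 = {}" by (auto simp: P1_def Q0_def)
        have fin0: "finite Q0" "finite P1" using \<open>finite P\<close> by (auto simp: P1_def Q0_def)
        have "P1 \<subset> P" using False Q0P by (auto simp: P1_def)
        then have "card P1 < card P" using \<open>finite P\<close> by (simp add: psubset_card_mono)
        moreover have "transversal P1 f" using tf P(1) by (auto intro: transversal_subset)
        moreover have A1f: "\<not> E a (f C)" if "a \<in> A1" "C \<in> P1" for a C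
          using that Af transversal_indep[OF tf] by (auto simp: A1_def P1_def Q0_def)
        ultimately obtain g where g: "(step P1 A1)\<^sup>*\<^sup>* f g"
          and alt: "free_vertex P1 A1 (D \<union> Q0) g \<or> (\<exists>Q\<subseteq>P1. \<exists>W. dominated A1 (D \<union> Q0) g Q W)"
          using outer_IH[of P1 f A1 "D \<union> Q0"] fin0(2) by blast
        define h where "h = override P1 g f"
        have gA: "\<not> E a (g C)" if "a \<in> A1" "C \<in> P1" for a C
          using steps_avoid[OF g A1f] that by blast
        have "(step P A)\<^sup>*\<^sup>* f h \<and> transversal P h"
          unfolding h_def
        proof (rule lift_steps[OF g])
          show "transversal P f" by (fact tf)
        qed (auto simp: P1_def A1_def)
        then have fh: "(step P A)\<^sup>*\<^sup>* f h" and th: "transversal P h" by auto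
        have h1: "h C = g C" if "C \<in> P1" for C using that by (simp add: h_def)
        have h0: "h C = f C" if "C \<in> Q0" for C using that by (simp add: h_def P1_def)
        have Ah: "\<not> E a (h C)" if "a \<in> A" "C \<in> P" for a C
          using steps_avoid[OF fh Af that] .
        from alt show ?thesis
        proof
          assume "free_vertex P1 A1 (D \<union> Q0) g"
          then obtain w1 where w1: "w1 \<in> \<Union>(D \<union> Q0)" "\<forall>a\<in>A1. \<not> E w1 a" "\<forall>C\<in>P1. \<not> E w1 (g C)"
            by (auto simp: free_vertex_def)
          have w1h: "\<not> E w1 (h C)" if "C \<in> P" for C
            using w1(2,3) that h1 h0 P(1) by (auto simp: A1_def)
          show ?thesis
          proof (cases "w1 \<in> \<Union>D")
            case True
            then have "free_vertex P A D h" using w1(2) w1h by (auto simp: A1_def free_vertex_def)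
            then show ?thesis using fh by blast
          next
            case False
            then obtain C where C: "C \<in> Q0" "w1 \<in> C" using w1(1) by blast
            \<comment> \<open>Since \<open>w\<close> belongs to \<open>A1\<close>, \<open>w1\<close>
              is not adjacent to \<open>w\<close>. Moving \<open>C\<close> to \<open>w1\<close>
              therefore removes one conflict with \<open>w\<close>, while the blocks of
              \<open>P1\<close> add none.\<close>
            define f' where "f' = h(C := w1)"
            have CP: "C \<in> P" using C Q0P by auto
            have "\<not> E a w1" if "a \<in> A" for a using w1(2) that sym by (auto simp: A1_def)
            then have st: "step P A h f'" "transversal P f'"
              unfolding f'_def using stepI[OF th CP C(2)] w1h by blast+
            have Af': "\<not> E a (f' B)" if "a \<in> A" "B \<in> P" for a B
              using Ah[OF that] \<open>\<And>a. a \<in> A \<Longrightarrow> \<not> E a w1\<close> that by (auto simp: f'_def)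
            have "\<not> E w (f' B)" if "B \<in> P1" for B
            proof -
              have "f' B = g B" using that C h1 P(2) by (auto simp: f'_def)
              then show ?thesis using gA[of w B] that by (simp add: A1_def)
            qed
            moreover have "\<not> E w (f' C)" using w1(2) sym by (auto simp: f'_def A1_def)
            ultimately have "{B \<in> P. E w (f' B)} \<subseteq> Q0 - {C}" using P(1) by auto
            then have "{B \<in> P. E w (f' B)} \<subset> Q0" using C by blast
            then have "card {B \<in> P. E w (f' B)} < card {B \<in> P. E w (f B)}"
              using fin0(1) by (simp add: psubset_card_mono Q0_def)
            then obtain g' where g': "(step P A)\<^sup>*\<^sup>* f' g'" "free_vertex P A D g' \<or> (\<exists>Q\<subseteq>P. \<exists>W. dominated A D g' Q W)"
              using less.hyps[of f'] st(2) Af' by blast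
            have "(step P A)\<^sup>*\<^sup>* f f'" using rtranclp.rtrancl_into_rtrancl[of "step P A", OF fh st(1)] .
            then have "(step P A)\<^sup>*\<^sup>* f g'" by (rule rtranclp_trans[of "step P A", OF _ g'(1)])
            then show ?thesis using g'(2) by blast
          qed
        next
          assume "\<exists>Q\<subseteq>P1. \<exists>W. dominated A1 (D \<union> Q0) g Q W"
          then obtain Q1 W1 where "Q1 \<subseteq> P1" and dm: "dominated A1 (D \<union> Q0) g Q1 W1" by blast
          then have Q1: "Q1 \<subseteq> P1" "finite W1" "W1 \<subseteq> \<Union>(D \<union> Q0 \<union> Q1)" "card W1 \<le> card Q1"
            by (auto simp: dominated_def)
          have dom: "\<exists>x\<in>A1 \<union> W1 \<union> g ` Q1. E v x" if "v \<in> \<Union>(D \<union> Q0 \<union> Q1)" for v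
            using dm that unfolding dominated_def by (elim conjE) (erule bspec)
          have con: "\<exists>w\<in>W1 \<inter> \<Union>\<C>. \<exists>C\<in>Q1 - \<C>. E w (g C)" if "D \<union> Q0 \<subseteq> \<C>" "\<not> Q1 \<subseteq> \<C>" for \<C>
            using dm that unfolding dominated_def by simp
          have img: "h ` (Q0 \<union> Q1) = f ` Q0 \<union> g ` Q1"
            using Q1(1) h0 h1 by (simp add: image_Un subset_iff)
          have "dominated A D h (Q0 \<union> Q1) (insert w W1)"
            unfolding dominated_def
          proof (intro conjI)
            \<comment> \<open>The additional vertex \<open>w\<close> is paid for by the nonempty
              \<open>Q0\<close>.\<close>
            have "card (insert w W1) \<le> card Q1 + 1"
              using Q1(4) by (simp add: card_insert_if Q1(2))
            also have "\<dots> \<le> card Q1 + card Q0" using False fin0(1) by (simp add: Suc_le_eq card_gt_0_iff)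
            also have "\<dots> = card (Q0 \<union> Q1)"
              using Q1(1) P(2) fin0 finite_subset[OF Q1(1)] by (subst card_Un_disjoint) auto
            finally show "card (insert w W1) \<le> card (Q0 \<union> Q1)" .
            show "\<forall>v\<in>\<Union>(D \<union> (Q0 \<union> Q1)). \<exists>x\<in>A \<union> insert w W1 \<union> h ` (Q0 \<union> Q1). E v x"
            proof
              fix v assume "v \<in> \<Union>(D \<union> (Q0 \<union> Q1))"
              then have "v \<in> \<Union>(D \<union> Q0 \<union> Q1)" by (simp add: Un_assoc)
              then obtain x where "x \<in> A1 \<union> W1 \<union> g ` Q1" "E v x" using dom by blast
              then show "\<exists>x\<in>A \<union> insert w W1 \<union> h ` (Q0 \<union> Q1). E v x"
                unfolding img A1_def by blast
            qed
            show "\<forall>\<C>. D \<subseteq> \<C> \<longrightarrow> \<not> Q0 \<union> Q1 \<subseteq> \<C> \<longrightarrow>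
              (\<exists>w\<in>insert w W1 \<inter> \<Union>\<C>. \<exists>C\<in>Q0 \<union> Q1 - \<C>. E w (h C))"
            proof (intro allI impI)
              fix \<C> assume \<C>: "D \<subseteq> \<C>" "\<not> Q0 \<union> Q1 \<subseteq> \<C>"
              show "\<exists>w\<in>insert w W1 \<inter> \<Union>\<C>. \<exists>C\<in>Q0 \<union> Q1 - \<C>. E w (h C)"
              \<comment> \<open>If the family misses a block of \<open>Q0\<close>, the edge from
                \<open>w\<close> to the choice of that block leaves it. Otherwise it contains
                \<open>D \<union> Q0\<close>, and the domination obtained for \<open>P1\<close>
                supplies the edge.\<close>
              proof (cases "Q0 \<subseteq> \<C>")
                case True
                then have "D \<union> Q0 \<subseteq> \<C>" "\<not> Q1 \<subseteq> \<C>" using \<C> by auto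
                then obtain u C where u: "u \<in> W1 \<inter> \<Union>\<C>" "C \<in> Q1 - \<C>" "E u (g C)"
                  using con[of \<C>] by blast
                then have "E u (h C)" using h1[of C] Q1(1) by auto
                then show ?thesis using u by blast
              next
                case False
                then obtain C where "C \<in> Q0 - \<C>" by blast
                moreover have "E w (h C)" using h0 calculation by (auto simp: Q0_def)
                moreover have "w \<in> \<Union>\<C>" using w(1) \<C>(1) by blast
                ultimately show ?thesis by blast
              qed
            qed
            show "insert w W1 \<subseteq> \<Union>(D \<union> (Q0 \<union> Q1))" using Q1(3) w(1) by (simp add: Un_assoc)
            show "finite (insert w W1)" using Q1(2) by simp
          qed
          moreover have "Q0 \<union> Q1 \<subseteq> P" using Q1(1) P(1) by blast
          ultimately show ?thesis using fh by blast
        qed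
      qed
    qed
  qed
qed

end

subsection \<open>Thick blocks and tight domination\<close>

locale block_system = block_graph E for E :: "'a \<Rightarrow> 'a \<Rightarrow> bool" +
  fixes U :: "'a set set" and d :: nat
  assumes finite_U: "finite U"
    and finite_block: "C \<in> U \<Longrightarrow> finite C"
    and block_nonempty: "C \<in> U \<Longrightarrow> C \<noteq> {}"
    and block_unique: "B \<in> U \<Longrightarrow> C \<in> U \<Longrightarrow> x \<in> B \<Longrightarrow> x \<in> C \<Longrightarrow> B = C"
    and thick: "C \<in> U \<Longrightarrow> 2 * d \<le> card C"
    and finite_nbrs: "finite {y. E x y}"
    and degree: "card {y. E x y} \<le> d"
begin

definition N :: "'a \<Rightarrow> 'a set" where "N x = {y. E x y}"

lemma N_iff [simp]: "y \<in> N x \<longleftrightarrow> E x y" by (simp add: N_def)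

lemma finite_N: "finite (N x)" and card_N: "card (N x) \<le> d"
  using finite_nbrs degree by (auto simp: N_def)

lemma E_commute: "E x y \<longleftrightarrow> E y x" using sym by blast

section \<open>Connectivity of choice functions under moves\<close>

text \<open>Choice functions are total, with arbitrary values off \<open>U\<close>. Passing to
  images identifies functions that agree on \<open>U\<close>, so that paths can be compared with
  paths between sets.\<close>

definition link :: "'a set \<Rightarrow> 'a set \<Rightarrow> bool" where
  "link X Y \<longleftrightarrow> (\<exists>f g. step U {} f g \<and> X = f ` U \<and> Y = g ` U)"

definition conn :: "('a set \<Rightarrow> 'a) \<Rightarrow> ('a set \<Rightarrow> 'a) \<Rightarrow> bool" where
  "conn f g \<longleftrightarrow> link\<^sup>*\<^sup>* (f ` U) (g ` U)"

lemma step_sym: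
  assumes "step P {} f g" shows "step P {} g f"
proof -
  obtain C w where C: "C \<in> P" "g = f(C := w)" "\<not> E (f C) w" and t: "transversal P f" "transversal P g"
    using assms by (auto simp: step_def)
  have "f = g(C := f C)" using C by auto
  then show ?thesis unfolding step_def using C t E_commute
    by (metis empty_iff fun_upd_same)
qed

lemma link_sym: "link X Y \<Longrightarrow> link Y X"
  unfolding link_def using step_sym by blast

lemma conn_refl: "conn f f" by (simp add: conn_def)

lemma conn_sym: "conn f g \<Longrightarrow> conn g f"
  unfolding conn_def
  by (induction rule: rtranclp_induct) (auto intro: converse_rtranclp_into_rtranclp link_sym)

lemma conn_trans: "conn f g \<Longrightarrow> conn g h \<Longrightarrow> conn f h"
  unfolding conn_def by (rule rtranclp_trans)

lemma conn_cong: "(\<And>C. C \<in> U \<Longrightarrow> f C = g C) \<Longrightarrow> conn f g"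
  by (simp add: conn_def cong: image_cong)

lemma conn_steps: "(step U {})\<^sup>*\<^sup>* f g \<Longrightarrow> conn f g"
proof (induction rule: rtranclp_induct)
  case base
  then show ?case by (rule conn_refl)
next
  case (step g h)
  then have "link (g ` U) (h ` U)" by (auto simp: link_def)
  then show ?case using step.IH unfolding conn_def by (rule rtranclp.rtrancl_into_rtrancl[rotated])
qed

lemma conn_update:
  assumes "transversal U S" "C \<in> U" "w \<in> C" "\<And>B. B \<in> U \<Longrightarrow> \<not> E w (S B)"
  shows "conn S (S(C := w))" "transversal U (S(C := w))"
  using conn_steps[OF r_into_rtranclp[of "step U {}", OF stepI(1)[OF assms(1-3), of "{}"]]] stepI(2)[OF assms(1-3), of "{}"] assms(4)
  by auto

lemma finite_Union_blocks: "\<B> \<subseteq> U \<Longrightarrow> finite (\<Union>\<B>)"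
  using finite_U finite_block by (meson finite_Union finite_subset subsetD)

lemma card_Union_blocks: "\<B> \<subseteq> U \<Longrightarrow> card (\<Union>\<B>) = (\<Sum>C\<in>\<B>. card C)"
proof (rule card_Union_disjoint)
  assume B: "\<B> \<subseteq> U"
  then show "pairwise disjnt \<B>" unfolding pairwise_def disjnt_def using block_unique by blast
  show "finite C" if "C \<in> \<B>" for C using that B finite_block by auto
qed

lemma card_Union_blocks_ge:
  assumes "\<B> \<subseteq> U" shows "2 * d * card \<B> \<le> card (\<Union>\<B>)"
proof -
  have "(\<Sum>C\<in>\<B>. 2 * d) \<le> (\<Sum>C\<in>\<B>. card C)" using assms thick by (intro sum_mono) auto
  then show ?thesis using card_Union_blocks[OF assms] by (simp add: mult.commute)
qed

lemma card_UN_N_le: "finite X \<Longrightarrow> card (\<Union>x\<in>X. N x) \<le> d * card X"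
proof -
  assume X: "finite X"
  have "card (\<Union>x\<in>X. N x) \<le> (\<Sum>x\<in>X. card (N x))" by (rule card_UN_le[OF X])
  also have "\<dots> \<le> (\<Sum>x\<in>X. d)" using card_N by (intro sum_mono) auto
  finally show ?thesis by (simp add: mult.commute)
qed

section \<open>Equality in the domination count\<close>

definition dominates :: "'a set \<Rightarrow> 'a set set \<Rightarrow> bool" where
  "dominates X \<B> \<longleftrightarrow> (\<forall>v\<in>\<Union>\<B>. \<exists>x\<in>X. E v x)"

context
  fixes \<B> X
  assumes BU: "\<B> \<subseteq> U" and Bne: "\<B> \<noteq> {}" and XB: "X \<subseteq> \<Union>\<B>"
    and cX: "card X \<le> 2 * card \<B>" and dom: "dominates X \<B>"
begin

lemma finite_X: "finite X" using XB finite_Union_blocks[OF BU] finite_subset by blast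

lemma Union_blocks_subset: "\<Union>\<B> \<subseteq> (\<Union>x\<in>X. N x)"
  using dom E_commute by (auto simp: dominates_def)

lemma tight_pos: "0 < d"
proof -
  obtain v where "v \<in> \<Union>\<B>" using Bne BU block_nonempty by blast
  then obtain x where "E v x" using dom by (auto simp: dominates_def)
  then have "N v \<noteq> {}" by auto
  then show ?thesis using card_N[of v] finite_N[of v] by (metis card_gt_0_iff le_zero_eq not_gr_zero)
qed

text \<open>The chain \<open>2 * d * card \<B>\<close> \<le> \<open>card (\<Union>\<B>)\<close>
  \<le> \<open>card (\<Union>x\<in>X. N x)\<close> \<le> \<open>d * card X\<close> \<le>
  \<open>2 * d * card \<B>\<close> returns to its start, so all its terms are equal. The factor
  \<open>d\<close> can be cancelled by \<open>tight_pos\<close>.\<close>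

lemma tight_card: "card (\<Union>x\<in>X. N x) = 2 * d * card \<B>" "card (\<Union>\<B>) = 2 * d * card \<B>"
    "card X = 2 * card \<B>" "(\<Union>x\<in>X. N x) = \<Union>\<B>"
proof -
  have fin: "finite (\<Union>x\<in>X. N x)" using finite_X finite_N by blast
  have 1: "2 * d * card \<B> \<le> card (\<Union>\<B>)" by (rule card_Union_blocks_ge[OF BU])
  have 2: "card (\<Union>\<B>) \<le> card (\<Union>x\<in>X. N x)" by (rule card_mono[OF fin Union_blocks_subset])
  have 3: "card (\<Union>x\<in>X. N x) \<le> d * card X" by (rule card_UN_N_le[OF finite_X])
  have 4: "d * card X \<le> 2 * d * card \<B>" using mult_le_mono2[OF cX, of d] by simp
  show "card (\<Union>x\<in>X. N x) = 2 * d * card \<B>" "card (\<Union>\<B>) = 2 * d * card \<B>"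
    using 1 2 3 4 by linarith+
  then have "d * card X = d * (2 * card \<B>)" using 3 4 by (simp only: mult.assoc mult.left_commute[of d 2])
  then show "card X = 2 * card \<B>" using tight_pos by (simp only: mult_cancel1) simp
  show "(\<Union>x\<in>X. N x) = \<Union>\<B>"
  proof (rule card_subset_eq[OF fin Union_blocks_subset, symmetric])
    show "card (\<Union>\<B>) = card (\<Union>x\<in>X. N x)" using 1 2 3 4 by linarith
  qed
qed

lemma tight_N_subset: "x \<in> X \<Longrightarrow> E x y \<Longrightarrow> y \<in> \<Union>\<B>"
  using tight_card(4) by (auto simp flip: N_iff)

lemma tight_remove:
  assumes "x \<in> X" shows "d * card X \<le> card (\<Union>y\<in>X - {x}. N y) + card (N x - (\<Union>y\<in>X - {x}. N y))"
proof -
  have "(\<Union>y\<in>X. N y) = (\<Union>y\<in>X - {x}. N y) \<union> (N x - (\<Union>y\<in>X - {x}. N y))" using assms by blast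
  then have "card (\<Union>y\<in>X. N y) \<le> card (\<Union>y\<in>X - {x}. N y) + card (N x - (\<Union>y\<in>X - {x}. N y))"
    by (metis card_Un_le)
  then show ?thesis using tight_card(1,3) by simp
qed

text \<open>The other \<open>card X - 1\<close> neighbourhoods cover at most \<open>d\<close>
  vertices each, so \<open>d\<close> of the \<open>d * card X\<close> covered vertices are left to
  \<open>N x\<close> alone. As \<open>N x\<close> has at most \<open>d\<close> elements, all
  neighbours of \<open>x\<close> are private, whence \<open>tight_degree\<close> and
  \<open>tight_unique\<close>.\<close>

lemma tight_private:
  assumes "x \<in> X" shows "d \<le> card (N x - (\<Union>y\<in>X - {x}. N y))"
proof -
  have "card (\<Union>y\<in>X - {x}. N y) \<le> d * card (X - {x})" by (rule card_UN_N_le) (simp add: finite_X)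
  also have "\<dots> = d * (card X - 1)" using assms finite_X by simp
  finally have "d * card X \<le> d * (card X - 1) + card (N x - (\<Union>y\<in>X - {x}. N y))"
    using tight_remove[OF assms] by simp
  moreover have "d * card X = d * (card X - 1) + d"
    using assms finite_X by (metis Suc_diff_1 card_gt_0_iff empty_iff mult_Suc_right add.commute)
  ultimately show ?thesis by simp
qed

lemma tight_degree: "x \<in> X \<Longrightarrow> card (N x) = d"
  using tight_private[of x] card_N[of x] card_mono[OF finite_N[of x], of "N x - (\<Union>y\<in>X - {x}. N y)"]
  by auto

lemma tight_unique:
  assumes "x \<in> X" "y \<in> X" "E v x" "E v y" shows "x = y"
proof (rule ccontr)
  assume "x \<noteq> y"
  have "N x - (\<Union>y\<in>X - {x}. N y) \<subseteq> N x - {v}"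
    using assms \<open>x \<noteq> y\<close> E_commute by (auto simp: E_commute)
  then have "d \<le> card (N x - {v})"
    using tight_private[OF assms(1)] finite_N[of x] by (meson card_mono finite_Diff le_trans)
  moreover have "card (N x - {v}) < card (N x)"
    using assms(3) sym finite_N[of x] by (intro psubset_card_mono) auto
  ultimately show False using card_N[of x] by simp
qed

lemma tight_block_card: assumes "C \<in> \<B>" shows "card C = 2 * d"
proof -
  have fin: "finite \<B>" using BU finite_U finite_subset by blast
  have "(\<Sum>C\<in>\<B>. card C) = (\<Sum>C\<in>\<B>. 2 * d)"
    using card_Union_blocks[OF BU] tight_card(2) by (simp add: mult.commute)
  then have "\<forall>C\<in>\<B>. 2 * d = card C"
    using sum_mono_inv[of "\<lambda>_. 2 * d" \<B> card] fin thick BU by (metis subsetD)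
  then show ?thesis using assms by simp
qed

end

section \<open>Cut-connected vertex sets and rerouting\<close>

text \<open>Connectedness, expressed by cuts, of the multigraph whose vertices are the blocks of
  \<open>\<B>\<close> and whose edges are the edges of \<open>E\<close> inside
  \<open>X\<close>.\<close>

definition cut_conn :: "'a set set \<Rightarrow> 'a set \<Rightarrow> bool" where
  "cut_conn \<B> X \<longleftrightarrow> (\<forall>\<C>\<subseteq>\<B>. \<C> \<noteq> {} \<longrightarrow> \<C> \<noteq> \<B> \<longrightarrow>
     (\<exists>x\<in>X \<inter> \<Union>\<C>. \<exists>y\<in>X \<inter> \<Union>(\<B> - \<C>). E x y))"

lemma cut_connE:
  assumes "cut_conn \<B> X" "\<C> \<subseteq> \<B>" "\<C> \<noteq> {}" "\<C> \<noteq> \<B>"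
  obtains x y where "x \<in> X" "x \<in> \<Union>\<C>" "y \<in> X" "y \<in> \<Union>(\<B> - \<C>)" "E x y"
proof -
  have "\<exists>x\<in>X \<inter> \<Union>\<C>. \<exists>y\<in>X \<inter> \<Union>(\<B> - \<C>). E x y"
    using assms by (simp add: cut_conn_def)
  then show ?thesis using that by blast
qed

definition matching :: "'a set \<Rightarrow> bool" where
  "matching X \<longleftrightarrow> (\<forall>x\<in>X. \<forall>y\<in>X. \<forall>z\<in>X. E x y \<longrightarrow> E x z \<longrightarrow> y = z)"

lemma in_Union_block: "C \<in> U \<Longrightarrow> \<C> \<subseteq> U \<Longrightarrow> x \<in> C \<Longrightarrow> x \<in> \<Union>\<C> \<longleftrightarrow> C \<in> \<C>"
  using block_unique by blast

text \<open>The rerouting \<open>h\<close> depends only on \<open>Y\<close> and \<open>w\<close>, not on the transversal \<open>S\<close>. Applied to two transversals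
  that agree outside \<open>\<B>\<close>, it connects them.\<close>
lemma grow:
  assumes BU: "\<B> \<subseteq> U" and mX: "matching X" and YX: "Y \<subseteq> X" and con: "cut_conn \<B> Y"
    and C0: "C0 \<in> \<B>" "w \<in> C0" and wY: "\<And>y. y \<in> Y \<Longrightarrow> \<not> E w y"
  obtains h where "h C0 = w" "\<And>C. C \<in> \<B> \<Longrightarrow> h C \<in> insert w Y"
    "\<And>S. transversal U S \<Longrightarrow> (\<And>C. C \<in> \<B> \<Longrightarrow> S C \<in> X \<and> \<not> E w (S C)) \<Longrightarrow>
      (\<And>C y. C \<in> U - \<B> \<Longrightarrow> y \<in> insert w Y \<Longrightarrow> \<not> E y (S C)) \<Longrightarrow>
      transversal U (override \<B> h S) \<and> conn S (override \<B> h S)"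
proof -
  define suit where "suit S \<longleftrightarrow> transversal U S \<and> (\<forall>C\<in>\<B>. S C \<in> X \<and> \<not> E w (S C)) \<and>
      (\<forall>C\<in>U - \<B>. \<forall>y\<in>insert w Y. \<not> E y (S C))" for S
  \<comment> \<open>The invariant while blocks are rerouted one at a time, beginning with
    \<open>C0\<close>: every new choice is \<open>w\<close> or has its \<open>X\<close>-neighbour
    inside the rerouted blocks \<open>\<C>\<close>. Hence no new choice is adjacent to a vertex of
    \<open>Y\<close> outside them.\<close>
  define good where "good \<C> h \<longleftrightarrow> C0 \<in> \<C> \<and> h C0 = w \<and>
     (\<forall>C\<in>\<C>. h C \<in> C \<and> (h C = w \<or> h C \<in> Y \<and> (\<exists>y\<in>Y \<inter> \<Union>\<C>. E (h C) y))) \<and>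
     (\<forall>S. suit S \<longrightarrow> transversal U (override \<C> h S) \<and> conn S (override \<C> h S))" for \<C> h
  define \<A> where "\<A> = {\<C>. \<C> \<subseteq> \<B> \<and> (\<exists>h. good \<C> h)}"
  have "finite \<B>" using BU finite_U by (rule finite_subset)
  then have "finite \<A>" unfolding \<A>_def by (rule rev_finite_subset[OF iffD2[OF finite_Pow_iff]]) auto
  moreover have "good {C0} (\<lambda>_. w)"
    unfolding good_def
  proof (intro conjI allI impI)
    fix S assume S: "suit S"
    have "override {C0} (\<lambda>_. w) S = S(C0 := w)" by (auto simp: override_def fun_eq_iff)
    then show "transversal U (override {C0} (\<lambda>_. w) S)" "conn S (override {C0} (\<lambda>_. w) S)"
      using conn_update[of S C0 w] S C0 BU unfolding suit_def by auto
  qed (use C0 in auto)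
  then have "{C0} \<in> \<A>" using C0 by (auto simp: \<A>_def)
  ultimately obtain \<C> where CA: "\<C> \<in> \<A>" and max: "\<And>\<C>'. \<C>' \<in> \<A> \<Longrightarrow> \<C> \<subseteq> \<C>' \<Longrightarrow> \<C> = \<C>'"
    using finite_has_maximal[of \<A>] by (metis empty_iff)
  from CA obtain h where CB: "\<C> \<subseteq> \<B>" and gd: "good \<C> h" by (auto simp: \<A>_def)
  have CU: "\<C> \<subseteq> U" using CB BU by auto
  have "\<C> = \<B>"
  proof (rule ccontr)
    assume "\<C> \<noteq> \<B>"
    moreover have "\<C> \<noteq> {}" using gd by (auto simp: good_def)
    \<comment> \<open>An edge of \<open>Y\<close> leaving \<open>\<C>\<close> names the next block
      to reroute: the block \<open>C'\<close> of \<open>x'\<close> is moved to \<open>x'\<close>.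
      The only \<open>X\<close>-neighbour of \<open>x'\<close> is \<open>x\<close>, whose block has
      already been rerouted.\<close>
    ultimately obtain x x' where x: "x \<in> Y" "x \<in> \<Union>\<C>" "x' \<in> Y" "x' \<in> \<Union>(\<B> - \<C>)" "E x x'"
      using cut_connE[OF con CB] by metis
    then obtain C' where C': "C' \<in> \<B>" "C' \<notin> \<C>" "x' \<in> C'" by blast
    have C'U: "C' \<in> U" using C' BU by auto
    have x'C: "x' \<notin> \<Union>\<C>" using in_Union_block[OF C'U CU C'(3)] C'(2) by simp
    have part: "y = x" if "E x' y" "y \<in> X" for y
      using mX x that YX E_commute unfolding matching_def by blast
    have gdC: "h C \<in> C" "h C = w \<or> h C \<in> Y \<and> (\<exists>y\<in>Y \<inter> \<Union>\<C>. E (h C) y)" if "C \<in> \<C>" for C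
      using gd that by (simp_all add: good_def)
    define h' where "h' = h(C' := x')"
    have "good (insert C' \<C>) h'"
      unfolding good_def
    proof (intro conjI allI impI ballI)
      show "C0 \<in> insert C' \<C>" using gd by (simp add: good_def)
      show "h' C0 = w" using gd C' by (auto simp: good_def h'_def)
    next
      fix C assume C: "C \<in> insert C' \<C>"
      show "h' C \<in> C" using C gd C' by (auto simp: good_def h'_def)
      show "h' C = w \<or> h' C \<in> Y \<and> (\<exists>y\<in>Y \<inter> \<Union>(insert C' \<C>). E (h' C) y)"
      proof (cases "C = C'")
        case True
        moreover have "E x' x" using x(5) sym by blast
        ultimately show ?thesis using x by (auto simp: h'_def)
      next
        case False
        then have "h' C = h C" "C \<in> \<C>" using C by (auto simp: h'_def)
        then show ?thesis using gdC[of C] by auto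
      qed
    next
      fix S assume S: "suit S"
      then have t: "transversal U (override \<C> h S)" and c: "conn S (override \<C> h S)"
        using gd by (auto simp: good_def)
      have eq: "override (insert C' \<C>) h' S = (override \<C> h S)(C' := x')"
        using C' by (auto simp: override_def h'_def fun_eq_iff)
      have "\<not> E x' (override \<C> h S C)" if "C \<in> U" for C
      proof (cases "C \<in> \<C>")
        case True
        then have "h C = w \<or> h C \<in> Y \<and> (\<exists>y\<in>Y \<inter> \<Union>\<C>. E (h C) y)" using gdC by blast
        then show ?thesis
        proof
          assume "h C = w"
          then show ?thesis using True wY[OF x(3)] E_commute by auto
        next
          assume h: "h C \<in> Y \<and> (\<exists>y\<in>Y \<inter> \<Union>\<C>. E (h C) y)"
          then obtain y where y: "y \<in> Y" "y \<in> \<Union>\<C>" "E (h C) y" by blast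
          show ?thesis
          proof
            assume "E x' (override \<C> h S C)"
            then have "E (h C) x'" using True E_commute by auto
            then have "y = x'" using mX h y x(3) YX unfolding matching_def by blast
            then show False using y(2) x'C by simp
          qed
        qed
      next
        case False
        show ?thesis
        proof (cases "C \<in> \<B>")
          case True
          have "S C \<notin> \<Union>\<C>"
            using in_Union_block[OF that CU, of "S C"] False S that transversal_in[of U S C] by (simp add: suit_def)
          then have "\<not> E x' (S C)" using part[of "S C"] S True x(2) by (auto simp: suit_def)
          then show ?thesis using False by simp
        next
          case noB: False
          then show ?thesis using False S x(3) that by (auto simp: suit_def)
        qed
      qed
      then have "conn (override \<C> h S) ((override \<C> h S)(C' := x'))"
        "transversal U ((override \<C> h S)(C' := x'))"
        using conn_update[OF t C'U C'(3)] by blast+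
      then show "transversal U (override (insert C' \<C>) h' S)" "conn S (override (insert C' \<C>) h' S)"
        unfolding eq using c conn_trans by blast+
    qed
    then have "insert C' \<C> \<in> \<A>" using C' CB by (auto simp: \<A>_def)
    then show False using max[of "insert C' \<C>"] C' by blast
  qed
  with gd have gd: "good \<B> h" by simp
  show ?thesis
  proof (rule that[of h])
    show "h C0 = w" using gd by (simp add: good_def)
    show "h C \<in> insert w Y" if "C \<in> \<B>" for C using gd that by (auto simp: good_def)
  next
    fix S assume "transversal U S" "\<And>C. C \<in> \<B> \<Longrightarrow> S C \<in> X \<and> \<not> E w (S C)"
      "\<And>C y. C \<in> U - \<B> \<Longrightarrow> y \<in> insert w Y \<Longrightarrow> \<not> E y (S C)"
    then have "suit S" by (simp add: suit_def)
    then show "transversal U (override \<B> h S) \<and> conn S (override \<B> h S)" using gd by (simp add: good_def)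
  qed
qed

subsection \<open>Cut-connected configurations\<close>

text \<open>The data that \<open>extend\<close> enlarges until \<open>X\<close> dominates the
  blocks, which is what \<open>config\<close> adds. The bound on \<open>card X\<close> is the
  largest one for which domination forces equality in the count.\<close>

definition weak_config :: "'a set set \<Rightarrow> 'a set \<Rightarrow> ('a set \<Rightarrow> 'a) \<Rightarrow> ('a set \<Rightarrow> 'a) \<Rightarrow> bool" where
  "weak_config \<B> X S T \<longleftrightarrow> \<B> \<subseteq> U \<and> X \<subseteq> \<Union>\<B> \<and> card X \<le> 2 * card \<B> \<and> cut_conn \<B> X \<and>
     transversal U S \<and> transversal U T \<and> \<not> conn S T \<and>
     (\<forall>C\<in>U - \<B>. S C = T C) \<and> (\<forall>C\<in>\<B>. S C \<in> X \<and> T C \<in> X)"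

definition config :: "'a set set \<Rightarrow> 'a set \<Rightarrow> ('a set \<Rightarrow> 'a) \<Rightarrow> ('a set \<Rightarrow> 'a) \<Rightarrow> bool" where
  "config \<B> X S T \<longleftrightarrow> weak_config \<B> X S T \<and> dominates X \<B>"

lemma weak_configD:
  assumes "weak_config \<B> X S T"
  shows "\<B> \<subseteq> U" "X \<subseteq> \<Union>\<B>" "card X \<le> 2 * card \<B>" "cut_conn \<B> X" "transversal U S" "transversal U T"
    "\<not> conn S T" "C \<in> U \<Longrightarrow> C \<notin> \<B> \<Longrightarrow> S C = T C" "C \<in> \<B> \<Longrightarrow> S C \<in> X" "C \<in> \<B> \<Longrightarrow> T C \<in> X"
  using assms by (auto simp: weak_config_def)

lemma weak_config_swap: "weak_config \<B> X S T \<Longrightarrow> weak_config \<B> X T S"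
  unfolding weak_config_def using conn_sym by auto

lemma config_swap: "config \<B> X S T \<Longrightarrow> config \<B> X T S"
  unfolding config_def using weak_config_swap by blast

text \<open>One rerouting \<open>h\<close> from \<open>grow\<close>, with \<open>Y = X\<close>,
  applies to \<open>S\<close> and to \<open>T\<close> alike. As the two agree off
  \<open>\<B>\<close>, they become equal on \<open>U\<close>, so \<open>S\<close> and
  \<open>T\<close> would be connected.\<close>

lemma free_conn:
  assumes b: "weak_config \<B> X S T" and m: "matching X"
    and avoid: "\<And>x C. x \<in> X \<Longrightarrow> C \<in> U - \<B> \<Longrightarrow> \<not> E x (S C)"
    and w: "w \<in> \<Union>\<B>" "\<And>x. x \<in> X \<Longrightarrow> \<not> E w x" "\<And>C. C \<in> U - \<B> \<Longrightarrow> \<not> E w (S C)"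
  shows False
proof -
  obtain C0 where C0: "C0 \<in> \<B>" "w \<in> C0" using w(1) by blast
  obtain h where h: "\<And>R. transversal U R \<Longrightarrow> (\<And>C. C \<in> \<B> \<Longrightarrow> R C \<in> X \<and> \<not> E w (R C)) \<Longrightarrow>
      (\<And>C y. C \<in> U - \<B> \<Longrightarrow> y \<in> insert w X \<Longrightarrow> \<not> E y (R C)) \<Longrightarrow>
      transversal U (override \<B> h R) \<and> conn R (override \<B> h R)"
    using grow[OF weak_configD(1)[OF b] m order_refl weak_configD(4)[OF b] C0 w(2)] by metis
  have "conn S (override \<B> h S)"
    by (rule conjunct2[OF h]) (use weak_configD[OF b] w avoid in auto)
  moreover have "conn T (override \<B> h T)"
  proof (rule conjunct2[OF h])
    fix C y assume "C \<in> U - \<B>" "y \<in> insert w X"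
    then show "\<not> E y (T C)" using weak_configD(8)[OF b, of C] w(3)[of C] avoid[of y C] by auto
  qed (use weak_configD[OF b] w in auto)
  moreover have "conn (override \<B> h S) (override \<B> h T)"
    by (rule conn_cong) (use weak_configD(8)[OF b] in \<open>auto simp: override_def\<close>)
  ultimately have "conn S T" using conn_sym conn_trans by blast
  then show False using weak_configD(7)[OF b] by simp
qed

text \<open>Outside \<open>\<B>\<close> the two transversals coincide, so a sequence of moves there
  can be performed on both. By \<open>avoid\<close> the new vertices are nonadjacent to
  \<open>X\<close>, which contains the choices of both on \<open>\<B>\<close>.\<close>

lemma weak_config_move:
  assumes b: "weak_config \<B> X S T" and st: "(step (U - \<B>) A)\<^sup>*\<^sup>* S g"
    and avoid: "\<And>x w. x \<in> X \<Longrightarrow> w \<in> \<Union>(U - \<B>) \<Longrightarrow> (\<And>a. a \<in> A \<Longrightarrow> \<not> E a w) \<Longrightarrow> \<not> E x w"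
  shows "weak_config \<B> X (override (U - \<B>) g S) (override (U - \<B>) g T)"
    "conn S (override (U - \<B>) g S)" "conn T (override (U - \<B>) g T)"
proof -
  have "(step U {})\<^sup>*\<^sup>* R (override (U - \<B>) g R) \<and> transversal U (override (U - \<B>) g R)"
    if R: "R = S \<or> R = T" for R
  proof (rule lift_steps[OF st])
    show "U - \<B> \<subseteq> U" by simp
    show "R C = S C" if "C \<in> U - \<B>" for C using R weak_configD(8)[OF b, of C] that by auto
    show "transversal U R" using R weak_configD[OF b] by auto
    fix C B w assume "C \<in> U - (U - \<B>)" "B \<in> U - \<B>" "w \<in> B" "\<And>a. a \<in> A \<Longrightarrow> \<not> E a w"
    then show "\<not> E (R C) w" using avoid[of "R C" w] R weak_configD(9,10)[OF b, of C] by auto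
  qed simp
  then have S: "conn S (override (U - \<B>) g S)" "transversal U (override (U - \<B>) g S)"
    and T: "conn T (override (U - \<B>) g T)" "transversal U (override (U - \<B>) g T)"
    using conn_steps by blast+
  show "conn S (override (U - \<B>) g S)" "conn T (override (U - \<B>) g T)" using S T by auto
  have "\<not> conn (override (U - \<B>) g S) (override (U - \<B>) g T)"
    using S(1) T(1) weak_configD(7)[OF b] conn_sym conn_trans by blast
  then show "weak_config \<B> X (override (U - \<B>) g S) (override (U - \<B>) g T)"
    using weak_configD(1-4,9,10)[OF b] S T unfolding weak_config_def by (auto simp: override_def)
qed

text \<open>A cut that splits \<open>\<B>\<close> is crossed inside \<open>X\<close>. If
  \<open>\<C>\<close> contains \<open>\<B>\<close>, then \<open>rel\<close> gives a crossing edge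
  from \<open>W\<close> to a choice on \<open>Q\<close>; if \<open>\<C>\<close> is disjoint from
  \<open>\<B>\<close>, \<open>rel\<close> is applied to the complement.\<close>

lemma cut_conn_extend:
  assumes con: "cut_conn \<B> X" and BU: "\<B> \<subseteq> U" "Q \<subseteq> U - \<B>"
    and g: "\<And>C. C \<in> Q \<Longrightarrow> g C \<in> C" and Bne: "\<B> \<noteq> {}"
    and rel: "\<And>\<C>. \<B> \<subseteq> \<C> \<Longrightarrow> \<not> Q \<subseteq> \<C> \<Longrightarrow> \<exists>w\<in>W \<inter> \<Union>\<C>. \<exists>C\<in>Q - \<C>. E w (g C)"
  shows "cut_conn (\<B> \<union> Q) (X \<union> W \<union> g ` Q)"
  unfolding cut_conn_def
proof (intro allI impI)
  let ?X = "X \<union> W \<union> g ` Q"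
  fix \<C> assume C: "\<C> \<subseteq> \<B> \<union> Q" "\<C> \<noteq> {}" "\<C> \<noteq> \<B> \<union> Q"
  have sup: "\<exists>x\<in>?X \<inter> \<Union>\<D>. \<exists>y\<in>?X \<inter> \<Union>(\<B> \<union> Q - \<D>). E x y"
    if D: "\<B> \<subseteq> \<D>" "\<D> \<subseteq> \<B> \<union> Q" "\<D> \<noteq> \<B> \<union> Q" for \<D>
  proof -
    have "\<not> Q \<subseteq> \<D>" using D by blast
    then obtain w C where w: "w \<in> W" "w \<in> \<Union>\<D>" "C \<in> Q" "C \<notin> \<D>" "E w (g C)"
      using rel[OF D(1)] by blast
    then have "g C \<in> \<Union>(\<B> \<union> Q - \<D>)" using g[of C] by blast
    then show ?thesis using w by blast
  qed
  show "\<exists>x\<in>?X \<inter> \<Union>\<C>. \<exists>y\<in>?X \<inter> \<Union>(\<B> \<union> Q - \<C>). E x y"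
  proof (cases "\<B> \<subseteq> \<C>")
    case True
    then show ?thesis using sup C by blast
  next
    case nsub: False
    show ?thesis
    proof (cases "\<C> \<inter> \<B> = {}")
      case True
      let ?D = "\<B> \<union> Q - \<C>"
      have "\<B> \<subseteq> ?D" "?D \<subseteq> \<B> \<union> Q" "?D \<noteq> \<B> \<union> Q" using True C by auto
      then have "\<exists>x\<in>?X \<inter> \<Union>?D. \<exists>y\<in>?X \<inter> \<Union>(\<B> \<union> Q - ?D). E x y" by (rule sup)
      moreover have "\<B> \<union> Q - ?D = \<C>" using C by auto
      ultimately obtain x y where xy: "x \<in> ?X \<inter> \<Union>?D" "y \<in> ?X \<inter> \<Union>\<C>" "E x y"
        by (simp only:) (elim bexE)
      then show ?thesis using sym by (intro bexI[of _ y] bexI[of _ x])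
    next
      case False
      moreover have "\<C> \<inter> \<B> \<noteq> \<B>" using nsub by blast
      ultimately obtain x y where xy: "x \<in> X" "x \<in> \<Union>(\<C> \<inter> \<B>)" "y \<in> X" "y \<in> \<Union>(\<B> - \<C> \<inter> \<B>)" "E x y"
        by (rule cut_connE[OF con Int_lower2])
      have "x \<in> ?X \<inter> \<Union>\<C>" "y \<in> ?X \<inter> \<Union>(\<B> \<union> Q - \<C>)" using xy(1-4) by auto
      then show ?thesis using xy(5) by (intro bexI[of _ x] bexI[of _ y])
    qed
  qed
qed

lemma weak_config_nonempty: "weak_config \<B> X S T \<Longrightarrow> \<B> \<noteq> {}"
  using conn_cong[of S T] by (auto simp: weak_config_def)

text \<open>\<open>haxell_swap\<close> is run on the blocks outside \<open>\<B>\<close>, avoiding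
  \<open>X\<close> and with \<open>\<B>\<close> as target. The hypothesis \<open>nofree\<close>
  excludes a free vertex; it is discharged by a minimality argument in one application and by
  \<open>free_conn\<close> in the other. The resulting \<open>Q\<close> and \<open>W\<close> add at
  most \<open>2 * card Q\<close> vertices, so the bound on \<open>card X\<close> survives.\<close>

lemma extend:
  assumes b: "weak_config \<B> X S T"
    and avoid: "\<And>x C. x \<in> X \<Longrightarrow> C \<in> U - \<B> \<Longrightarrow> \<not> E x (S C)"
    and nofree: "\<And>S' T' w. weak_config \<B> X S' T' \<Longrightarrow> (\<And>C. C \<in> \<B> \<Longrightarrow> S' C = S C \<and> T' C = T C) \<Longrightarrow>
      conn S S' \<Longrightarrow> conn T T' \<Longrightarrow> (\<And>x C. x \<in> X \<Longrightarrow> C \<in> U - \<B> \<Longrightarrow> \<not> E x (S' C)) \<Longrightarrow>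
      w \<in> \<Union>\<B> \<Longrightarrow> (\<And>x. x \<in> X \<Longrightarrow> \<not> E w x) \<Longrightarrow> (\<And>C. C \<in> U - \<B> \<Longrightarrow> \<not> E w (S' C)) \<Longrightarrow> False"
  obtains \<B>' X' S' T' where "\<B> \<subseteq> \<B>'" "config \<B>' X' S' T'" "\<B>' = \<B> \<Longrightarrow> X' = X"
    "\<And>C. C \<in> \<B> \<Longrightarrow> S' C = S C \<and> T' C = T C"
proof -
  define P where "P = U - \<B>"
  have finP: "finite P" using finite_U by (simp add: P_def)
  have "transversal P S" using weak_configD(5)[OF b] by (rule transversal_subset) (auto simp: P_def)
  then obtain g where g: "(step P X)\<^sup>*\<^sup>* S g"
    and alt: "free_vertex P X \<B> g \<or> (\<exists>Q\<subseteq>P. \<exists>W. dominated X \<B> g Q W)"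
    using haxell_swap[OF finP, of S X \<B>] avoid by (metis P_def)
  define S' where "S' = override P g S"
  define T' where "T' = override P g T"
  have b': "weak_config \<B> X S' T'" and conn: "conn S S'" "conn T T'"
    using weak_config_move[OF b g[unfolded P_def]] by (auto simp: S'_def T'_def P_def)
  have tg: "transversal P g" using steps_transversal[OF g] \<open>transversal P S\<close> by simp
  have S'P: "S' C = g C" "T' C = g C" if "C \<in> P" for C using that by (simp_all add: S'_def T'_def)
  have S'B: "S' C = S C \<and> T' C = T C" if "C \<in> \<B>" for C using that by (simp add: S'_def T'_def P_def)
  have avoid': "\<not> E x (S' C)" if "x \<in> X" "C \<in> P" for x C
    using steps_avoid[OF g, of x C] avoid that S'P by (auto simp: P_def)
  have "\<not> free_vertex P X \<B> g"
  proof
    assume "free_vertex P X \<B> g"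
    then obtain w where "w \<in> \<Union>\<B>" "\<forall>a\<in>X. \<not> E w a" "\<forall>C\<in>P. \<not> E w (g C)"
      unfolding free_vertex_def by blast
    then show False using nofree[OF b' S'B conn avoid', of w] S'P by (simp add: P_def)
  qed
  then obtain Q W where Q: "Q \<subseteq> P" and dm: "dominated X \<B> g Q W" using alt by blast
  note dm = dm[unfolded dominated_def]
  have QU: "Q \<subseteq> U" "Q \<inter> \<B> = {}" using Q by (auto simp: P_def)
  have finQ: "finite Q" "finite \<B>"
    using finite_subset[OF QU(1) finite_U] finite_subset[OF weak_configD(1)[OF b] finite_U] by auto
  have gQ: "g C \<in> C" if "C \<in> Q" for C using transversal_in[OF tg] that Q by auto
  let ?B = "\<B> \<union> Q" and ?X = "X \<union> W \<union> g ` Q"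
  have "config ?B ?X S' T'"
    unfolding config_def weak_config_def
  proof (intro conjI)
    show "?B \<subseteq> U" using QU weak_configD(1)[OF b] by auto
    show "?X \<subseteq> \<Union>?B" using weak_configD(2)[OF b] dm gQ by auto
    have "card ?X \<le> card X + card W + card (g ` Q)"
      using card_Un_le[of "X \<union> W" "g ` Q"] card_Un_le[of X W] by linarith
    also have "\<dots> \<le> 2 * card \<B> + card Q + card Q"
      using weak_configD(3)[OF b] dm card_image_le[OF finQ(1), of g] by (intro add_mono) auto
    also have "\<dots> = 2 * card ?B" using finQ QU(2) by (subst card_Un_disjoint) auto
    finally show "card ?X \<le> 2 * card ?B" .
    show "cut_conn ?B ?X"
    proof (rule cut_conn_extend[OF weak_configD(4)[OF b] weak_configD(1)[OF b]])
      show "Q \<subseteq> U - \<B>" using Q by (simp add: P_def)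
      show "\<B> \<noteq> {}" by (rule weak_config_nonempty[OF b])
      show "g C \<in> C" if "C \<in> Q" for C by (rule gQ[OF that])
      show "\<exists>w\<in>W \<inter> \<Union>\<C>. \<exists>C\<in>Q - \<C>. E w (g C)" if "\<B> \<subseteq> \<C>" "\<not> Q \<subseteq> \<C>" for \<C> using dm that by simp
    qed
    show "transversal U S'" "transversal U T'" "\<not> conn S' T'" using weak_configD[OF b'] by auto
    show "\<forall>C\<in>U - ?B. S' C = T' C" using weak_configD(8)[OF b'] by auto
    show "\<forall>C\<in>?B. S' C \<in> ?X \<and> T' C \<in> ?X"
      using weak_configD(9,10)[OF b'] S'P Q by (auto simp: subset_iff)
    show "dominates ?X ?B" unfolding dominates_def using dm by simp
  qed
  then show ?thesis
  proof (rule that[rotated])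
    show "\<B> \<subseteq> ?B" by simp
    assume "?B = \<B>"
    then have "Q = {}" using QU by auto
    then show "?X = X" using dm by auto
  qed (rule S'B)
qed

section \<open>A configuration from a disconnected pair\<close>

text \<open>A disconnected pair with the fewest disagreeing blocks is taken, and
  \<open>extend\<close> is started from those blocks and the vertices chosen there. Minimality gives
  both the cut-connectedness and the absence of a free vertex.\<close>

lemma config_exists:
  assumes S: "transversal U S0" and T: "transversal U T0" and nc: "\<not> conn S0 T0"
  obtains \<B> X S T where "config \<B> X S T"
proof -
  define diff where "diff S T = {C \<in> U. S C \<noteq> T C}" for S T :: "'a set \<Rightarrow> 'a"
  define bad where "bad p \<longleftrightarrow> transversal U (fst p) \<and> transversal U (snd p) \<and> \<not> conn (fst p) (snd p)"
    for p :: "('a set \<Rightarrow> 'a) \<times> ('a set \<Rightarrow> 'a)"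
  have "bad (S0, T0)" using assms by (simp add: bad_def)
  then obtain p where p: "bad p" and min: "\<And>q. bad q \<Longrightarrow> card (diff (fst p) (snd p)) \<le> card (diff (fst q) (snd q))"
    using ex_has_least_nat[of bad "(S0, T0)" "\<lambda>q. card (diff (fst q) (snd q))"] by blast
  obtain S T where pST: "p = (S, T)" by (cases p)
  have tS: "transversal U S" and tT: "transversal U T" and nST: "\<not> conn S T"
    using p by (auto simp: bad_def pST)
  define D where "D = diff S T"
  have DU: "D \<subseteq> U" and finD: "finite D" using finite_U by (auto simp: D_def diff_def)
  have minD: "conn F F'" if "transversal U F" "transversal U F'" "diff F F' \<subset> D" for F F'
  proof (rule ccontr)
    assume "\<not> conn F F'"
    then have "card D \<le> card (diff F F')" using min[of "(F, F')"] that by (simp add: bad_def pST D_def)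
    then show False using psubset_card_mono[OF finD that(3)] by simp
  qed
  have off: "S C = T C" if "C \<in> U" "C \<notin> D" for C using that by (auto simp: D_def diff_def)
  define A where "A = S ` D \<union> T ` D"
  have b: "weak_config D A S T"
    unfolding weak_config_def
  proof (intro conjI)
    show "D \<subseteq> U" by (rule DU)
    show "A \<subseteq> \<Union>D" using transversal_in[OF tS] transversal_in[OF tT] DU by (auto simp: A_def)
    show "card A \<le> 2 * card D"
      using card_Un_le[of "S ` D" "T ` D"] card_image_le[OF finD, of S] card_image_le[OF finD, of T]
      by (simp add: A_def)
    show "transversal U S" "transversal U T" "\<not> conn S T" by (fact tS tT nST)+
    show "\<forall>C\<in>U - D. S C = T C" using off by auto
    show "\<forall>C\<in>D. S C \<in> A \<and> T C \<in> A" by (auto simp: A_def)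
    show "cut_conn D A"
      unfolding cut_conn_def
    proof (intro allI impI, rule ccontr)
      fix \<C> assume C: "\<C> \<subseteq> D" "\<C> \<noteq> {}" "\<C> \<noteq> D"
        and no: "\<not> (\<exists>x\<in>A \<inter> \<Union>\<C>. \<exists>y\<in>A \<inter> \<Union>(D - \<C>). E x y)"
      \<comment> \<open>An uncrossed cut yields a transversal strictly between \<open>S\<close> and \<open>T\<close>, against minimality.\<close>
      define F where "F = override \<C> S T"
      have cross: "\<not> E (S B) (T C)" if "B \<in> \<C>" "C \<in> U - \<C>" for B C
      proof (cases "C \<in> D")
        case True
        then have "S B \<in> A \<inter> \<Union>\<C>" "T C \<in> A \<inter> \<Union>(D - \<C>)"
          using that \<open>\<C> \<subseteq> D\<close> DU transversal_in[OF tS, of B] transversal_in[OF tT, of C] by (auto simp: A_def)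
        then show ?thesis using no by blast
      next
        case False
        then have "T C = S C" using off that by auto
        then show ?thesis using transversal_indep[OF tS, of B C] that \<open>\<C> \<subseteq> D\<close> DU by auto
      qed
      have tF: "transversal U F"
      proof (rule transversalI)
        show "F C \<in> C" if "C \<in> U" for C
          using that transversal_in[OF tS] transversal_in[OF tT] by (auto simp: F_def override_def)
        show "\<not> E (F B) (F C)" if "B \<in> U" "C \<in> U" for B C
          using that transversal_indep[OF tS that] transversal_indep[OF tT that] cross[of B C] cross[of C B]
            sym[of "F B" "F C"] by (auto simp: F_def override_def split: if_splits)
      qed
      have "diff S F \<subseteq> D - \<C>" "diff F T \<subseteq> \<C>" by (auto simp: diff_def F_def D_def override_def)
      then have "diff S F \<subset> D" "diff F T \<subset> D" using C by auto
      then have "conn S F" "conn F T" using minD tS tT tF by auto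
      then show False using nST conn_trans by blast
    qed
  qed
  have avoidA: "\<not> E x (S C)" if "x \<in> A" "C \<in> U - D" for x C
  proof -
    have "S C = T C" using off that by auto
    then show ?thesis using that transversal_indep[OF tS, of _ C] transversal_indep[OF tT, of _ C] DU
      by (auto simp: A_def)
  qed
  show ?thesis
  proof (rule extend[OF b])
    show "\<not> E x (S C)" if "x \<in> A" "C \<in> U - D" for x C using that by (rule avoidA)
  next
    fix S' T' w
    assume b': "weak_config D A S' T'" and w: "w \<in> \<Union>D" "\<And>x. x \<in> A \<Longrightarrow> \<not> E w x" "\<And>C. C \<in> U - D \<Longrightarrow> \<not> E w (S' C)"
    \<comment> \<open>A free \<open>w\<close> lets both transversals move their choice in
      \<open>B\<close> to \<open>w\<close>. They then disagree on fewer blocks, so minimality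
      connects them.\<close>
    obtain B where B: "B \<in> D" "w \<in> B" using w(1) by blast
    have BU: "B \<in> U" using B DU by auto
    have nS: "\<not> E w (S' C)" if "C \<in> U" for C
      using that w(3)[of C] w(2)[OF weak_configD(9)[OF b', of C]] by (cases "C \<in> D") auto
    have nT: "\<not> E w (T' C)" if "C \<in> U" for C
      using that nS[of C] weak_configD(8)[OF b' that] w(2)[OF weak_configD(10)[OF b', of C]] by (cases "C \<in> D") auto
    have s: "conn S' (S'(B := w))" "transversal U (S'(B := w))"
      using conn_update[OF weak_configD(5)[OF b'] BU B(2)] nS by auto
    have t: "conn T' (T'(B := w))" "transversal U (T'(B := w))"
      using conn_update[OF weak_configD(6)[OF b'] BU B(2)] nT by auto
    have "diff (S'(B := w)) (T'(B := w)) \<subseteq> D - {B}"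
      using weak_configD(8)[OF b'] by (auto simp: diff_def)
    then have "diff (S'(B := w)) (T'(B := w)) \<subset> D" using B by auto
    then have "conn (S'(B := w)) (T'(B := w))" by (rule minD[OF s(2) t(2)])
    then have "conn S' T'" using conn_trans[OF s(1)] conn_trans[OF _ conn_sym[OF t(1)]] by blast
    then show False using weak_configD(7)[OF b'] by simp
  next
    show thesis if "config \<B>' X' S' T'" for \<B>' X' S' T' using \<open>\<And>\<B> X S T. config \<B> X S T \<Longrightarrow> thesis\<close> that .
  qed
qed

subsection \<open>Rerouting a configuration\<close>

lemma configD:
  assumes "config \<B> X S T"
  shows "weak_config \<B> X S T" "\<B> \<subseteq> U" "\<B> \<noteq> {}" "X \<subseteq> \<Union>\<B>" "card X \<le> 2 * card \<B>" "dominates X \<B>"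
    "x \<in> X \<Longrightarrow> E x y \<Longrightarrow> y \<in> \<Union>\<B>"
    "x \<in> X \<Longrightarrow> card (N x) = d"
    "x \<in> X \<Longrightarrow> y \<in> X \<Longrightarrow> E v x \<Longrightarrow> E v y \<Longrightarrow> x = y"
    "C \<in> \<B> \<Longrightarrow> card C = 2 * d"
    "card X = 2 * card \<B>"
    "v \<in> \<Union>\<B> \<Longrightarrow> \<exists>x\<in>X. E v x"
    "finite X" "finite \<B>"
proof -
  show b: "weak_config \<B> X S T" and dom: "dominates X \<B>" using assms by (auto simp: config_def)
  show B: "\<B> \<subseteq> U" "X \<subseteq> \<Union>\<B>" "card X \<le> 2 * card \<B>" using weak_configD[OF b] by auto
  show ne: "\<B> \<noteq> {}" by (rule weak_config_nonempty[OF b])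
  note t = B(1) ne B(2,3) dom
  show "x \<in> X \<Longrightarrow> E x y \<Longrightarrow> y \<in> \<Union>\<B>" by (rule tight_N_subset[OF t])
  show "x \<in> X \<Longrightarrow> card (N x) = d" by (rule tight_degree[OF t])
  show "x \<in> X \<Longrightarrow> y \<in> X \<Longrightarrow> E v x \<Longrightarrow> E v y \<Longrightarrow> x = y" by (rule tight_unique[OF t])
  show "C \<in> \<B> \<Longrightarrow> card C = 2 * d" by (rule tight_block_card[OF t])
  show "card X = 2 * card \<B>" by (rule tight_card[OF t])
  show "v \<in> \<Union>\<B> \<Longrightarrow> \<exists>x\<in>X. E v x" using dom by (auto simp: dominates_def)
  show "finite X" by (rule finite_X[OF t])
  show "finite \<B>" by (rule finite_subset[OF B(1) finite_U])
qed

lemma config_matching: "config \<B> X S T \<Longrightarrow> matching X"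
  unfolding matching_def using configD(9) by blast

text \<open>\<open>haxell_swap\<close> is run outside \<open>\<B>\<close> with the artificial
  one-vertex block \<open>{v}\<close> as target. Domination is impossible: \<open>2 * card Q\<close>
  vertices have at most \<open>2 * d * card Q\<close> neighbours, one too few for \<open>v\<close>
  and the blocks of \<open>Q\<close>. The moves leave the configuration intact because no edge joins
  \<open>X\<close> to a block outside \<open>\<B>\<close>.\<close>

lemma free_outside:
  assumes c: "config \<B> X S T" and v: "v \<in> \<Union>\<B>"
  obtains S' T' where "config \<B> X S' T'" "\<And>C. C \<in> \<B> \<Longrightarrow> S' C = S C \<and> T' C = T C"
    "\<And>C. C \<in> U - \<B> \<Longrightarrow> \<not> E v (S' C)"
proof -
  define P where "P = U - \<B>"
  have b: "weak_config \<B> X S T" by (rule configD(1)[OF c])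
  have finP: "finite P" using finite_U by (simp add: P_def)
  have tP: "transversal P S" using weak_configD(5)[OF b] by (rule transversal_subset) (auto simp: P_def)
  then obtain g where g: "(step P {})\<^sup>*\<^sup>* S g"
    and alt: "free_vertex P {} {{v}} g \<or> (\<exists>Q\<subseteq>P. \<exists>W. dominated {} {{v}} g Q W)"
    using haxell_swap[OF finP, of S "{}" "{{v}}"] by (metis empty_iff)
  have "\<not> dominated {} {{v}} g Q W" if Q: "Q \<subseteq> P" for Q W
  proof
    assume dm: "dominated {} {{v}} g Q W"
    have QU: "Q \<subseteq> U" using Q by (auto simp: P_def)
    have finQ: "finite Q" by (rule finite_subset[OF QU finite_U])
    have fin: "finite (W \<union> g ` Q)" using dm finQ by (simp add: dominated_def)
    have "v \<notin> \<Union>Q" using v Q in_Union_block[of _ \<B> v] configD(2)[OF c] by (auto simp: P_def)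
    then have Suc: "card (insert v (\<Union>Q)) = Suc (card (\<Union>Q))" using finite_Union_blocks[OF QU] by simp
    have sub: "insert v (\<Union>Q) \<subseteq> (\<Union>x\<in>W \<union> g ` Q. N x)"
    proof
      fix u assume "u \<in> insert v (\<Union>Q)"
      then have "u \<in> \<Union>({{v}} \<union> Q)" by auto
      then have "\<exists>x\<in>{} \<union> W \<union> g ` Q. E u x" using dm unfolding dominated_def by (elim conjE) (erule bspec)
      then show "u \<in> (\<Union>x\<in>W \<union> g ` Q. N x)" using sym by auto
    qed
    have "card (insert v (\<Union>Q)) \<le> card (\<Union>x\<in>W \<union> g ` Q. N x)"
      using fin finite_N by (intro card_mono[OF _ sub]) blast
    also have "\<dots> \<le> d * card (W \<union> g ` Q)" by (rule card_UN_N_le[OF fin])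
    also have "card (W \<union> g ` Q) \<le> 2 * card Q"
      using card_Un_le[of W "g ` Q"] dm card_image_le[OF finQ, of g] unfolding dominated_def by linarith
    finally have "card (insert v (\<Union>Q)) \<le> 2 * d * card Q" by (simp add: algebra_simps)
    then show False using card_Union_blocks_ge[OF QU] Suc by simp
  qed
  then have "\<forall>C\<in>P. \<not> E v (g C)" using alt by (auto simp: free_vertex_def)
  moreover have "\<not> E x w" if "x \<in> X" "w \<in> \<Union>(U - \<B>)" for x w
    using configD(7)[OF c that(1), of w] that(2) in_Union_block[of _ \<B> w] configD(2)[OF c] by auto
  then have "weak_config \<B> X (override P g S) (override P g T)"
    using weak_config_move(1)[OF b g[unfolded P_def]] by (simp add: P_def)
  then have "config \<B> X (override P g S) (override P g T)" using configD(6)[OF c] by (simp add: config_def)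
  ultimately show ?thesis
    by (intro that[of "override P g S" "override P g T"]) (auto simp: P_def)
qed

section \<open>The perfect matching inside a configuration\<close>

context
  fixes \<B> X S T
  assumes c: "config \<B> X S T"
begin

lemma inj_transversal: "transversal U F \<Longrightarrow> \<C> \<subseteq> \<B> \<Longrightarrow> inj_on F \<C>"
  using configD(2)[OF c] transversal_in block_unique by (metis inj_onI subsetD)

text \<open>Domination gives each vertex of \<open>X\<close> a neighbour in \<open>X\<close>, and
  uniqueness of neighbours in \<open>X\<close> makes the assignment injective.\<close>

lemma partner:
  obtains p where "\<And>x. x \<in> X \<Longrightarrow> p x \<in> X \<and> E x (p x)" "inj_on p X"
proof -
  have "\<forall>x\<in>X. \<exists>y\<in>X. E x y" using configD(4,12)[OF c] by blast
  then obtain p where p: "\<forall>x\<in>X. p x \<in> X \<and> E x (p x)" by metis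
  moreover have "inj_on p X"
    by (rule inj_onI) (metis p sym configD(9)[OF c])
  ultimately show ?thesis using that by blast
qed

text \<open>\<open>F\<close> chooses \<open>card \<B>\<close> pairwise nonadjacent vertices of
  \<open>X\<close>. Their partners are as many and are not chosen, so both sets together exhaust the
  \<open>2 * card \<B>\<close> vertices of \<open>X\<close>.\<close>

lemma picks_one:
  assumes F: "transversal U F" "\<And>C. C \<in> \<B> \<Longrightarrow> F C \<in> X" and x: "x \<in> X" "y \<in> X" "E x y"
  shows "x \<in> F ` \<B> \<longleftrightarrow> y \<notin> F ` \<B>"
proof -
  obtain p where p: "\<And>x. x \<in> X \<Longrightarrow> p x \<in> X \<and> E x (p x)" "inj_on p X" by (rule partner) blast
  define R where "R = F ` \<B>"
  have RX: "R \<subseteq> X" using F(2) by (auto simp: R_def)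
  have indep: "\<not> E a b" if "a \<in> R" "b \<in> R" for a b
    using that transversal_indep[OF F(1)] configD(2)[OF c] by (auto simp: R_def)
  have cR: "card R = card \<B>" "finite R"
    using card_image[OF inj_transversal[OF F(1) order_refl]] configD(14)[OF c] by (auto simp: R_def)
  have "card (p ` R) = card \<B>" using card_image[OF inj_on_subset[OF p(2) RX]] cR by simp
  moreover have "R \<inter> p ` R = {}" using indep p(1) RX by blast
  ultimately have "card (R \<union> p ` R) = card X"
    using cR configD(11)[OF c] by (subst card_Un_disjoint) auto
  moreover have "R \<union> p ` R \<subseteq> X" using RX p(1) by auto
  ultimately have X: "R \<union> p ` R = X" using card_subset_eq[OF configD(13)[OF c]] by simp
  have "x \<in> R \<longleftrightarrow> y \<notin> R"
  proof
    assume "x \<in> R" then show "y \<notin> R" using indep x(3) by blast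
  next
    assume "y \<notin> R"
    then obtain z where z: "z \<in> R" "y = p z" using X x(2) by blast
    then have "E y z" using p(1)[of z] RX sym by auto
    moreover have "z \<in> X" "E y x" using z(1) RX x(3) sym by auto
    ultimately have "z = x" using configD(9)[OF c _ x(1), of z y] by blast
    then show "x \<in> R" using z by simp
  qed
  then show ?thesis by (simp add: R_def)
qed

text \<open>If deleting \<open>zz'\<close> disconnected the blocks, the numbers of ends chosen by
  \<open>S\<close> and by \<open>T\<close> on one side would contradict each other. So an edge on
  which they choose different ends is not a bridge.\<close>

lemma cycle_edge_cut:
  assumes z: "z \<in> X" "z' \<in> X" "E z z'" "z' \<in> S ` \<B>" "z \<in> T ` \<B>"
  shows "cut_conn \<B> (X - {z, z'})"
proof -
  note b = configD(1)[OF c]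
  have mate: "(a = z \<longrightarrow> b = z') \<and> (a = z' \<longrightarrow> b = z)" if "a \<in> X" "b \<in> X" "E a b" for a b
    using configD(9)[OF c, of b z' a] configD(9)[OF c, of b z a] that z sym by blast
  \<comment> \<open>If \<open>zz'\<close> were the only edge across the cut, then \<open>Y\<close> below would be a union of matched pairs, of
    which \<open>S\<close> and \<open>T\<close> choose one end each; but \<open>S\<close> chooses \<open>card \<C> - 1\<close> ends in \<open>Y\<close> and \<open>T\<close> chooses \<open>card \<C>\<close>.\<close>
  have half: "\<exists>x\<in>(X - {z, z'}) \<inter> \<Union>\<C>. \<exists>y\<in>(X - {z, z'}) \<inter> \<Union>(\<B> - \<C>). E x y"
    if C: "\<C> \<subseteq> \<B>" "z' \<in> \<Union>\<C>" "z \<notin> \<Union>\<C>" for \<C>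
  proof (rule ccontr)
    assume no: "\<not> ?thesis"
    obtain p where p: "\<And>x. x \<in> X \<Longrightarrow> p x \<in> X \<and> E x (p x)" "inj_on p X" by (rule partner) blast
    define Y where "Y = X \<inter> \<Union>\<C> - {z'}"
    have YX: "Y \<subseteq> X" by (auto simp: Y_def)
    have finY: "finite Y" by (rule finite_subset[OF YX configD(13)[OF c]])
    have pY: "p y \<in> Y" if y: "y \<in> Y" for y
    proof -
      have yX: "y \<in> X" "y \<noteq> z'" "y \<noteq> z" "y \<in> \<Union>\<C>" using y C(3) by (auto simp: Y_def)
      have "E (p y) y" using p(1)[OF yX(1)] sym by blast
      then have ne: "p y \<noteq> z" "p y \<noteq> z'" using mate[of "p y" y] p(1)[OF yX(1)] yX by auto
      have "p y \<in> \<Union>\<B>" using p(1)[OF yX(1)] configD(4)[OF c] by auto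
      moreover have "p y \<notin> \<Union>(\<B> - \<C>)"
        using no p(1)[OF yX(1)] ne yX by (metis DiffI IntI insert_iff singletonD)
      ultimately have "p y \<in> \<Union>\<C>" by auto
      then show ?thesis using p(1)[OF yX(1)] ne by (simp add: Y_def)
    qed
    have cnt: "card Y = 2 * card (Y \<inter> F ` \<B>)"
      if F: "transversal U F" "\<And>C. C \<in> \<B> \<Longrightarrow> F C \<in> X" for F
    proof -
      let ?Z = "Y \<inter> F ` \<B>"
      have one: "y \<in> F ` \<B> \<longleftrightarrow> p y \<notin> F ` \<B>" if "y \<in> Y" for y
        using picks_one[OF F, of y "p y"] p(1)[of y] that YX by auto
      have pp: "p (p y) = y" if "y \<in> Y" for y
      proof (rule configD(9)[OF c, of _ _ "p y"])
        show "p (p y) \<in> X" "E (p y) (p (p y))" using p(1)[of "p y"] p(1)[of y] that YX by auto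
        show "y \<in> X" "E (p y) y" using p(1)[of y] that YX sym by auto
      qed
      have "Y - ?Z = p ` ?Z"
      proof
        show "Y - ?Z \<subseteq> p ` ?Z"
        proof
          fix y assume y: "y \<in> Y - ?Z"
          then have "p y \<in> ?Z" using one[of y] pY[of y] by auto
          then show "y \<in> p ` ?Z" using pp[of y] y by (metis DiffD1 imageI)
        qed
        show "p ` ?Z \<subseteq> Y - ?Z" using one pY by auto
      qed
      moreover have "card (p ` ?Z) = card ?Z"
        using YX by (intro card_image inj_on_subset[OF p(2)]) auto
      moreover have "card Y = card ?Z + card (Y - ?Z)"
        using finY by (metis card_Diff_subset card_mono finite_Int inf_le1 le_add_diff_inverse)
      ultimately show ?thesis by simp
    qed
    have im: "X \<inter> \<Union>\<C> \<inter> F ` \<B> = F ` \<C>"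
      if F: "transversal U F" "\<And>C. C \<in> \<B> \<Longrightarrow> F C \<in> X" for F
    proof -
      have "F C \<in> \<Union>\<C> \<longleftrightarrow> C \<in> \<C>" if "C \<in> \<B>" for C
        using in_Union_block[of C \<C> "F C"] that C(1) configD(2)[OF c] transversal_in[OF F(1)] by blast
      then show ?thesis using F(2) C(1) by blast
    qed
    have tS: "transversal U S" "\<And>C. C \<in> \<B> \<Longrightarrow> S C \<in> X" and tT: "transversal U T" "\<And>C. C \<in> \<B> \<Longrightarrow> T C \<in> X"
      using weak_configD[OF b] by auto
    have cS: "card (S ` \<C>) = card \<C>" "card (T ` \<C>) = card \<C>"
      using card_image inj_transversal[OF _ C(1)] tS(1) tT(1) by blast+
    have z'S: "z' \<in> S ` \<C>" using im[OF tS] z C by blast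
    have "z' \<notin> T ` \<B>" using picks_one[OF tT, of z z'] z by auto
    then have "Y \<inter> T ` \<B> = T ` \<C>" using im[OF tT] C(1) by (auto simp: Y_def)
    moreover have "Y \<inter> S ` \<B> = S ` \<C> - {z'}" using im[OF tS] by (auto simp: Y_def)
    moreover have "card (S ` \<C> - {z'}) < card (S ` \<C>)"
      using z'S finite_subset[OF C(1) configD(14)[OF c]] by (intro psubset_card_mono) auto
    ultimately show False using cnt[OF tS] cnt[OF tT] cS by simp
  qed
  show ?thesis
    unfolding cut_conn_def
  proof (intro allI impI)
    fix \<C> assume C: "\<C> \<subseteq> \<B>" "\<C> \<noteq> {}" "\<C> \<noteq> \<B>"
    obtain x y where xy: "x \<in> X" "x \<in> \<Union>\<C>" "y \<in> X" "y \<in> \<Union>(\<B> - \<C>)" "E x y"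
      by (rule cut_connE[OF weak_configD(4)[OF b] C])
    have disj: "u \<notin> \<Union>(\<B> - \<C>) \<or> u \<notin> \<Union>\<C>" for u
      using block_unique C(1) configD(2)[OF c] by blast
    have "E y x" using xy(5) by (rule sym)
    have m: "x = z \<Longrightarrow> y = z'" "x = z' \<Longrightarrow> y = z" "y = z \<Longrightarrow> x = z'" "y = z' \<Longrightarrow> x = z"
      using mate[OF xy(1,3,5)] mate[OF xy(3,1) \<open>E y x\<close>] by blast+
    show "\<exists>x\<in>(X - {z, z'}) \<inter> \<Union>\<C>. \<exists>y\<in>(X - {z, z'}) \<inter> \<Union>(\<B> - \<C>). E x y"
    proof (cases "x = z \<or> x = z'")
      case False
      then have "y \<noteq> z" "y \<noteq> z'" using m(3,4) by blast+
      then have "x \<in> (X - {z, z'}) \<inter> \<Union>\<C>" "y \<in> (X - {z, z'}) \<inter> \<Union>(\<B> - \<C>)"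
        using xy False by auto
      then show ?thesis using xy(5) by (intro bexI[of _ x] bexI[of _ y])
    next
      case True
      then show ?thesis
      proof
        assume "x = z'"
        then have "z \<notin> \<Union>\<C>" "z' \<in> \<Union>\<C>" using xy(2,4) m(2) disj[of z] by auto
        then show ?thesis by (intro half C(1))
      next
        \<comment> \<open>\<open>half\<close> speaks of the side containing \<open>z'\<close>, so it
          is applied to the complementary family.\<close>
        assume "x = z"
        then have "z \<notin> \<Union>(\<B> - \<C>)" "z' \<in> \<Union>(\<B> - \<C>)" using xy(2,4) m(1) disj[of z] by auto
        then have "\<exists>x\<in>(X - {z, z'}) \<inter> \<Union>(\<B> - \<C>). \<exists>y\<in>(X - {z, z'}) \<inter> \<Union>(\<B> - (\<B> - \<C>)). E x y"
          by (intro half) auto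
        moreover have "\<B> - (\<B> - \<C>) = \<C>" using C(1) by auto
        ultimately obtain a b where "a \<in> (X - {z, z'}) \<inter> \<Union>(\<B> - \<C>)" "b \<in> (X - {z, z'}) \<inter> \<Union>\<C>" "E a b"
          by (simp only:) (elim bexE)
        then show ?thesis using sym by (intro bexI[of _ b] bexI[of _ a])
      qed
    qed
  qed
qed

end

text \<open>With \<open>z = T C\<close>, the vertex \<open>z'\<close> is exchanged for
  \<open>v\<close> in \<open>X\<close>, and \<open>S\<close> is rerouted so that it chooses
  \<open>v\<close>. Maximality of \<open>\<B>\<close> turns the new set into a dominating one. Both
  \<open>X\<close> and the new set cover every vertex exactly once, so \<open>v\<close> must take
  over the neighbours of \<open>z'\<close>.\<close>

lemma cycle_move:
  assumes c0: "config \<B> X S T"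
    and max: "\<And>\<B>' X' S' T'. config \<B>' X' S' T' \<Longrightarrow> \<B> \<subseteq> \<B>' \<Longrightarrow> \<B>' = \<B>"
    and C: "C \<in> \<B>" "S C \<noteq> T C" and z': "z' \<in> X" "E (T C) z'" and v: "E (T C) v"
  obtains X' S' T' B where "N v = N z'" "config \<B> X' S' T'" "\<And>C. C \<in> \<B> \<Longrightarrow> T' C = T C"
    "B \<in> \<B>" "v = S' B" "S' B \<noteq> T' B"
proof (cases "v = z'")
  case True
  note b = configD(1)[OF c0]
  have tS: "transversal U S" "\<And>C. C \<in> \<B> \<Longrightarrow> S C \<in> X" and tT: "transversal U T" "\<And>C. C \<in> \<B> \<Longrightarrow> T C \<in> X"
    using weak_configD[OF b] by auto
  have "T C \<notin> S ` \<B>"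
    using C transversal_in[OF tT(1)] transversal_in[OF tS(1)] block_unique configD(2)[OF c0] by (metis imageE subsetD)
  then obtain B where B: "B \<in> \<B>" "z' = S B" using picks_one[OF c0 tS tT(2)[OF C(1)] z'] by blast
  have "z' \<notin> T ` \<B>" using picks_one[OF c0 tT tT(2)[OF C(1)] z'] C by blast
  then have "S B \<noteq> T B" using B by auto
  then show ?thesis using that[of X S T B] True c0 B by simp
next
  case vz': False
  note b0 = configD(1)[OF c0]
  define z where "z = T C"
  have zX: "z \<in> X" using weak_configD(10)[OF b0 C(1)] by (simp add: z_def)
  have Ez: "E z z'" "E z v" using z' v by (simp_all add: z_def)
  have vB: "v \<in> \<Union>\<B>" using configD(7)[OF c0 zX Ez(2)] .
  \<comment> \<open>Before \<open>v\<close> can be chosen, its neighbours among the choices outside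
    \<open>\<B>\<close> are moved away.\<close>
  obtain S1 T1 where c: "config \<B> X S1 T1" and eq1: "\<And>C. C \<in> \<B> \<Longrightarrow> S1 C = S C \<and> T1 C = T C"
    and fv: "\<And>C. C \<in> U - \<B> \<Longrightarrow> \<not> E v (S1 C)"
    by (rule free_outside[OF c0 vB]) blast
  note b = configD(1)[OF c]
  have tS: "transversal U S1" "\<And>C. C \<in> \<B> \<Longrightarrow> S1 C \<in> X" and tT: "transversal U T1" "\<And>C. C \<in> \<B> \<Longrightarrow> T1 C \<in> X"
    using weak_configD[OF b] by auto
  have BU: "\<B> \<subseteq> U" by (rule configD(2)[OF c])
  have zT: "z \<in> T1 ` \<B>" using C eq1 by (auto simp: z_def)
  have zS: "z \<notin> S1 ` \<B>"
  proof
    assume "z \<in> S1 ` \<B>"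
    then obtain B where B: "B \<in> \<B>" "T1 C = S1 B" using eq1[OF C(1)] by (auto simp: z_def)
    then have "B = C" using block_unique[of B C "T1 C"] transversal_in[OF tS(1), of B] transversal_in[OF tT(1), of C] BU C(1) by auto
    then show False using B eq1[OF C(1)] C(2) by auto
  qed
  have z'S: "z' \<in> S1 ` \<B>" using picks_one[OF c tS zX z'(1) Ez(1)] zS by blast
  have z'T: "z' \<notin> T1 ` \<B>" using picks_one[OF c tT zX z'(1) Ez(1)] zT by blast
  have vnbr: "x = z" if "x \<in> X" "E v x" for x
    using configD(9)[OF c that(1) zX that(2)] Ez sym by blast
  have vX: "v \<notin> X" using configD(9)[OF c _ z'(1) Ez(2,1)] vz' by blast
  \<comment> \<open>Besides the exchanged \<open>z'\<close>, also \<open>z\<close> is dropped: it is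
    the only neighbour of \<open>v\<close> in \<open>X\<close>, so \<open>v\<close> has none in
    \<open>Y\<close>. The set stays cut-connected since \<open>zz'\<close> is a cycle edge.\<close>
  define Y where "Y = X - {z, z'}"
  obtain C0 where C0: "C0 \<in> \<B>" "v \<in> C0" using vB by blast
  have YX: "Y \<subseteq> X" by (auto simp: Y_def)
  have vY: "\<not> E v y" if "y \<in> Y" for y using vnbr[of y] that by (auto simp: Y_def)
  have cutY: "cut_conn \<B> Y" unfolding Y_def by (rule cycle_edge_cut[OF c zX z'(1) Ez(1) z'S zT])
  have noout: "\<not> E x (S1 C)" if "x \<in> X" "C \<in> U - \<B>" for x C
    using configD(7)[OF c that(1), of "S1 C"] that(2) in_Union_block[of C \<B> "S1 C"] BU transversal_in[OF tS(1), of C] by auto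
  obtain h where h: "h C0 = v" "\<And>C. C \<in> \<B> \<Longrightarrow> h C \<in> insert v Y"
    and hS: "\<And>R. transversal U R \<Longrightarrow> (\<And>C. C \<in> \<B> \<Longrightarrow> R C \<in> X \<and> \<not> E v (R C)) \<Longrightarrow>
      (\<And>C y. C \<in> U - \<B> \<Longrightarrow> y \<in> insert v Y \<Longrightarrow> \<not> E y (R C)) \<Longrightarrow>
      transversal U (override \<B> h R) \<and> conn R (override \<B> h R)"
    using grow[OF BU config_matching[OF c] YX cutY C0 vY] by metis
  define S2 where "S2 = override \<B> h S1"
  have S2: "transversal U S2 \<and> conn S1 S2"
    unfolding S2_def
  proof (rule hS[OF tS(1)])
    show "S1 C \<in> X \<and> \<not> E v (S1 C)" if "C \<in> \<B>" for C using tS(2)[OF that] vnbr[of "S1 C"] zS that by auto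
    show "\<not> E y (S1 C)" if "C \<in> U - \<B>" "y \<in> insert v Y" for C y using that fv noout YX by auto
  qed
  define X' where "X' = insert v (X - {z'})"
  have cX': "card X' \<le> 2 * card \<B>"
    using configD(5,13)[OF c] z'(1) vX by (simp add: X'_def card_gt_0_iff) (metis Suc_pred card_gt_0_iff empty_iff)
  have S2B: "S2 C \<in> X'" if "C \<in> \<B>" for C using h(2)[OF that] that by (auto simp: S2_def X'_def Y_def)
  have T1B: "T1 C \<in> X'" if "C \<in> \<B>" for C using tT(2)[OF that] z'T that by (auto simp: X'_def)
  have b': "weak_config \<B> X' S2 T1"
    unfolding weak_config_def
  proof (intro conjI)
    show "X' \<subseteq> \<Union>\<B>" using configD(4)[OF c] vB by (auto simp: X'_def)
    show "\<B> \<subseteq> U" "card X' \<le> 2 * card \<B>" "transversal U T1" "transversal U S2" using BU cX' tT S2 by auto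
    show "\<not> conn S2 T1" using S2 weak_configD(7)[OF b] conn_trans by blast
    show "\<forall>C\<in>U - \<B>. S2 C = T1 C" using weak_configD(8)[OF b] by (auto simp: S2_def)
    show "\<forall>C\<in>\<B>. S2 C \<in> X' \<and> T1 C \<in> X'" using S2B T1B by auto
    have "Y \<subseteq> X'" by (auto simp: Y_def X'_def)
    show "cut_conn \<B> X'"
      unfolding cut_conn_def
    proof (intro allI impI)
      fix \<C> assume C: "\<C> \<subseteq> \<B>" "\<C> \<noteq> {}" "\<C> \<noteq> \<B>"
      obtain x y where "x \<in> Y" "x \<in> \<Union>\<C>" "y \<in> Y" "y \<in> \<Union>(\<B> - \<C>)" "E x y" by (rule cut_connE[OF cutY C])
      then show "\<exists>x\<in>X' \<inter> \<Union>\<C>. \<exists>y\<in>X' \<inter> \<Union>(\<B> - \<C>). E x y"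
        using \<open>Y \<subseteq> X'\<close> by (intro bexI[of _ x] bexI[of _ y]) auto
    qed
  qed
  have mX': "matching X'"
    unfolding matching_def
  proof (intro ballI impI)
    fix x y y' assume X': "x \<in> X'" "y \<in> X'" "y' \<in> X'" and Exy: "E x y" "E x y'"
    show "y = y'"
    proof (cases "x = v")
      case True
      then show ?thesis using X' Exy vnbr irrefl by (auto simp: X'_def)
    next
      case False
      then have x: "x \<in> X" using X' by (auto simp: X'_def)
      have only_v: "u = v" if "x = z" "u \<in> X'" "E x u" for u
        using that configD(9)[OF c _ z'(1), of u x] Ez by (auto simp: X'_def)
      have not_v: "u \<in> X" if "x \<noteq> z" "u \<in> X'" "E x u" for u
        using that vnbr[OF x] sym[of x v] by (auto simp: X'_def)
      show ?thesis
      proof (cases "x = z")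
        case True then show ?thesis using only_v X' Exy by blast
      next
        case False then show ?thesis using not_v X' Exy configD(9)[OF c] by blast
      qed
    qed
  qed
  have S2out: "S2 C = S1 C" if "C \<in> U - \<B>" for C using that by (simp add: S2_def)
  have avoid': "\<not> E x (S2 C)" if "x \<in> X'" "C \<in> U - \<B>" for x C
    using that noout[of x C] fv[of C] S2out[of C] by (auto simp: X'_def)
  obtain \<B>' X'' S' T' where "\<B> \<subseteq> \<B>'" and c': "config \<B>' X'' S' T'" and X'': "\<B>' = \<B> \<Longrightarrow> X'' = X'"
    and eq': "\<And>C. C \<in> \<B> \<Longrightarrow> S' C = S2 C \<and> T' C = T1 C"
  \<comment> \<open>A free vertex would connect the pair by \<open>free_conn\<close>. So a
    configuration arises, and maximality of \<open>\<B>\<close> shows that no block and hence no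
    vertex was added.\<close>
  proof (rule extend[OF b' avoid'])
    fix S' T' w
    assume "weak_config \<B> X' S' T'" "\<And>x C. x \<in> X' \<Longrightarrow> C \<in> U - \<B> \<Longrightarrow> \<not> E x (S' C)" "w \<in> \<Union>\<B>"
      "\<And>x. x \<in> X' \<Longrightarrow> \<not> E w x" "\<And>C. C \<in> U - \<B> \<Longrightarrow> \<not> E w (S' C)"
    then show False by (rule free_conn[OF _ mX'])
  next
    fix \<B>' X'' S' T'
    assume "\<B> \<subseteq> \<B>'" "config \<B>' X'' S' T'" "\<B>' = \<B> \<Longrightarrow> X'' = X'"
      "\<And>C. C \<in> \<B> \<Longrightarrow> S' C = S2 C \<and> T' C = T1 C"
    then show thesis by (rule that)
  qed
  have "\<B>' = \<B>" by (rule max[OF c' \<open>\<B> \<subseteq> \<B>'\<close>])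
  then have c'': "config \<B> X' S' T'" using c' X'' by simp
  have "N z' \<subseteq> N v"
  proof
    fix u assume "u \<in> N z'"
    then have u: "E z' u" by simp
    then have "u \<in> \<Union>\<B>" using configD(7)[OF c z'(1)] by blast
    \<comment> \<open>The only neighbour of \<open>u\<close> in \<open>X\<close> is
      \<open>z'\<close>, which has been removed; its neighbour in the new set can only be
      \<open>v\<close>.\<close>
    then obtain x where x: "x \<in> X'" "E u x" using configD(12)[OF c''] by blast
    have "x = v"
    proof (rule ccontr)
      assume "x \<noteq> v"
      then have "x \<in> X" "x \<noteq> z'" using x by (auto simp: X'_def)
      then show False using configD(9)[OF c _ z'(1) x(2)] u sym by blast
    qed
    then show "u \<in> N v" using x sym by simp
  qed
  moreover have "card (N z') = d" by (rule configD(8)[OF c z'(1)])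
  ultimately have "N z' = N v" using card_N[of v] finite_N[of v] by (metis card_seteq)
  moreover have "v = S' C0" using eq'[OF C0(1)] h(1) C0(1) by (simp add: S2_def)
  moreover have "S' C0 \<noteq> T' C0"
  proof
    assume "S' C0 = T' C0"
    then have "v = T1 C0" using eq'[OF C0(1)] \<open>v = S' C0\<close> by simp
    then show False using vX tT(2)[OF C0(1)] by simp
  qed
  ultimately show ?thesis using that[of X' S' T' C0] c'' C0(1) eq' eq1 by simp
qed

text \<open>In a move only \<open>T\<close> has to stay fixed on \<open>\<B>\<close>; the dominating set \<open>X\<close> may change arbitrarily.
  This is all that is needed for the invariance of the active blocks.\<close>
inductive linked :: "'a set set \<Rightarrow> ('a set \<Rightarrow> 'a) \<Rightarrow> ('a set \<Rightarrow> 'a) \<Rightarrow> ('a set \<Rightarrow> 'a) \<Rightarrow> ('a set \<Rightarrow> 'a) \<Rightarrow> bool"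
  for \<B> S0 T0 where
  start: "linked \<B> S0 T0 S0 T0"
| swap: "linked \<B> S0 T0 S T \<Longrightarrow> linked \<B> S0 T0 T S"
| move: "linked \<B> S0 T0 S T \<Longrightarrow> config \<B> X S' T' \<Longrightarrow> (\<And>C. C \<in> \<B> \<Longrightarrow> T' C = T C) \<Longrightarrow> linked \<B> S0 T0 S' T'"

section \<open>Active vertices and their blocks\<close>

lemma linked_config: "linked \<B> S0 T0 S T \<Longrightarrow> config \<B> X0 S0 T0 \<Longrightarrow> \<exists>X. config \<B> X S T"
  by (induction rule: linked.induct) (use config_swap in blast)+

text \<open>The vertices that occur on the cycle of some linked pair. Because \<open>linked\<close>
  is closed under swapping, the choices of \<open>T\<close> on disagreeing blocks are
  included.\<close>

definition active :: "'a set set \<Rightarrow> ('a set \<Rightarrow> 'a) \<Rightarrow> ('a set \<Rightarrow> 'a) \<Rightarrow> 'a set" where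
  "active \<B> S0 T0 = {S C |S T C. linked \<B> S0 T0 S T \<and> C \<in> \<B> \<and> S C \<noteq> T C}"

lemma activeE:
  assumes "v \<in> active \<B> S0 T0"
  obtains S T C where "linked \<B> S0 T0 S T" "C \<in> \<B>" "v = S C" "S C \<noteq> T C"
  using assms unfolding active_def mem_Collect_eq by (elim exE conjE)

lemma activeI: "linked \<B> S0 T0 S T \<Longrightarrow> C \<in> \<B> \<Longrightarrow> S C \<noteq> T C \<Longrightarrow> S C \<in> active \<B> S0 T0"
  unfolding active_def by blast

lemma activeI': "linked \<B> S0 T0 S T \<Longrightarrow> C \<in> \<B> \<Longrightarrow> S C \<noteq> T C \<Longrightarrow> T C \<in> active \<B> S0 T0"
  using activeI[OF linked.swap] by metis

text \<open>Only a move that changes \<open>S C\<close> matters. If \<open>S C = T C\<close> before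
  it, the new pair disagrees at \<open>C\<close>, so the old and the new value are both active.
  Otherwise \<open>S C\<close> and \<open>T C\<close> are active, and the new value either equals
  \<open>T C\<close> or disagrees with it.\<close>

lemma active_invariant:
  assumes "linked \<B> S0 T0 S T" "C \<in> \<B>"
  shows "S C \<in> active \<B> S0 T0 \<longleftrightarrow> S0 C \<in> active \<B> S0 T0"
  using assms(1)
proof (induction rule: linked.induct)
  case start
  then show ?case by simp
next
  case (swap S T)
  have "S C = T C \<or> S C \<in> active \<B> S0 T0 \<and> T C \<in> active \<B> S0 T0"
    using activeI[OF swap.hyps assms(2)] activeI'[OF swap.hyps assms(2)] by blast
  then show ?case using swap.IH by metis
next
  case (move S T X S' T')
  have new: "linked \<B> S0 T0 S' T'" using linked.move[OF move.hyps] .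
  have T': "T' C = T C" using move.hyps(3) assms(2) .
  have "S' C \<in> active \<B> S0 T0 \<and> S C \<in> active \<B> S0 T0" if ne: "S' C \<noteq> S C"
  proof (cases "S C = T C")
    case True
    then have "S' C \<noteq> T' C" using ne T' by simp
    then have "S' C \<in> active \<B> S0 T0" "T' C \<in> active \<B> S0 T0"
      using activeI[OF new assms(2)] activeI'[OF new assms(2)] by auto
    then show ?thesis using True T' by simp
  next
    case False
    then have act: "S C \<in> active \<B> S0 T0" "T C \<in> active \<B> S0 T0"
      using activeI[OF move.hyps(1) assms(2)] activeI'[OF move.hyps(1) assms(2)] by auto
    show ?thesis
    proof (cases "S' C = T' C")
      case True
      then show ?thesis using act T' by simp
    next
      case False
      then show ?thesis using activeI[OF new assms(2)] act by auto
    qed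
  qed
  then show ?case using move.IH by metis
qed

text \<open>The components are indexed by the blocks \<open>C\<close> whose choice
  \<open>S C\<close> is active: \<open>R C\<close> is the neighbourhood of \<open>S C\<close>, and
  \<open>L C\<close> that of its partner in \<open>X\<close>. The index records only where
  \<open>S C\<close> lies; a component may spread over several blocks.\<close>

theorem disconnected_structure:
  assumes "transversal U S1" "transversal U T1" "\<not> conn S1 T1"
  obtains \<C> L R where "\<C> \<subseteq> U" "\<C> \<noteq> {}"
    "\<And>C. C \<in> \<C> \<Longrightarrow> card (L C) = d \<and> card (R C) = d \<and> L C \<inter> R C = {}"
    "\<And>C u. C \<in> \<C> \<Longrightarrow> u \<in> L C \<Longrightarrow> N u = R C"
    "\<And>C u. C \<in> \<C> \<Longrightarrow> u \<in> R C \<Longrightarrow> N u = L C"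
    "\<And>B C. B \<in> \<C> \<Longrightarrow> C \<in> \<C> \<Longrightarrow> B \<noteq> C \<Longrightarrow> (L B \<union> R B) \<inter> (L C \<union> R C) = {}"
    "\<Union>\<C> = (\<Union>C\<in>\<C>. L C \<union> R C)"
proof -
  define has_size where "has_size m \<longleftrightarrow> (\<exists>\<B> X S T. config \<B> X S T \<and> card \<B> = m)" for m
  have has_sizeI: "has_size (card \<B>)" if "config \<B> X S T" for \<B> X S T
    unfolding has_size_def
    by (rule exI[of _ \<B>], rule exI[of _ X], rule exI[of _ S], rule exI[of _ T]) (simp add: that)
  obtain \<B>0 X0 S0 T0 where "config \<B>0 X0 S0 T0" by (rule config_exists[OF assms])
  then have size: "has_size (card \<B>0)" by (rule has_sizeI)
  have bound: "m \<le> card U" if "has_size m" for m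
  proof -
    obtain \<B> X S T where "config \<B> X S T" "card \<B> = m" using \<open>has_size m\<close> unfolding has_size_def
      by (elim exE conjE)
    then show ?thesis using card_mono[OF finite_U configD(2)[of \<B> X S T]] by simp
  qed
  obtain n where n: "has_size n" and nmax: "\<And>m. has_size m \<Longrightarrow> m \<le> n"
    using Greatest_le_nat[of has_size, OF _ bound] GreatestI_nat[of has_size, OF size bound] by metis
  from n obtain \<B> X S T where c: "config \<B> X S T" and cn: "card \<B> = n"
    unfolding has_size_def by (elim exE conjE)
  have max: "\<B>' = \<B>" if c': "config \<B>' X' S' T'" and sub: "\<B> \<subseteq> \<B>'" for \<B>' X' S' T'
  proof -
    have "has_size (card \<B>')" using c' by (rule has_sizeI)
    then have "card \<B>' \<le> card \<B>" using nmax cn by blast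
    then show ?thesis using card_seteq[OF configD(14)[OF c'] sub] by simp
  qed
  define A where "A = active \<B> S T"
  have BU: "\<B> \<subseteq> U" by (rule configD(2)[OF c])
  have act: "card (N v) = d \<and> (\<forall>u\<in>N v. u \<in> A) \<and> (\<forall>u\<in>N v. \<forall>u'\<in>N v. N u = N u') \<and> v \<in> \<Union>\<B>"
    if vA: "v \<in> A" for v
  proof -
    obtain S' T' C where l: "linked \<B> S T S' T'" and C: "C \<in> \<B>" "v = S' C" "S' C \<noteq> T' C"
      using vA unfolding A_def by (rule activeE)
    obtain X' where c': "config \<B> X' S' T'" using linked_config[OF l c] by blast
    have b': "weak_config \<B> X' S' T'" by (rule configD(1)[OF c'])
    have vX: "v \<in> X'" using weak_configD(9)[OF b' C(1)] C(2) by simp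
    have vB: "v \<in> \<Union>\<B>" using configD(4)[OF c'] vX by blast
    obtain z' where z': "z' \<in> X'" "E (S' C) z'" using configD(12)[OF c' vB] C(2) by blast
    have nb: "N u = N z' \<and> u \<in> A" if uv: "E v u" for u
    proof -
      obtain X'' T'' S'' B where m: "N u = N z'" "config \<B> X'' T'' S''" "\<And>C. C \<in> \<B> \<Longrightarrow> S'' C = S' C"
        "B \<in> \<B>" "u = T'' B" "T'' B \<noteq> S'' B"
      \<comment> \<open>\<open>cycle_move\<close> explores the neighbours of a choice of the second
        transversal, so the pair is swapped to put \<open>v\<close> there.\<close>
      proof (rule cycle_move[OF config_swap[OF c'] _ C(1) C(3)[symmetric] z' uv[unfolded C(2)]])
        show "\<B>' = \<B>" if "config \<B>' X' S' T'" "\<B> \<subseteq> \<B>'" for \<B>' X' S' T' using that by (rule max)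
      next
        fix X'' T'' S'' B
        assume "N u = N z'" "config \<B> X'' T'' S''" "\<And>C. C \<in> \<B> \<Longrightarrow> S'' C = S' C"
          "B \<in> \<B>" "u = T'' B" "T'' B \<noteq> S'' B"
        then show thesis by (rule that)
      qed
      have "linked \<B> S T T'' S''" by (rule linked.move[OF linked.swap[OF l] m(2,3)])
      then have "u \<in> A" using activeI[of \<B> S T T'' S'' B] m(4-6) by (simp add: A_def)
      then show ?thesis using m(1) by simp
    qed
    show ?thesis
    proof (intro conjI ballI)
      show "card (N v) = d" by (rule configD(8)[OF c' vX])
      show "u \<in> A" if "u \<in> N v" for u using nb[of u] that by simp
      show "N u = N u'" if "u \<in> N v" "u' \<in> N v" for u u' using nb[of u] nb[of u'] that by simp
      show "v \<in> \<Union>\<B>" by (rule vB)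
    qed
  qed
  have act_nbr: "u \<in> A" if "v \<in> A" "E v u" for u v
    using conjunct1[OF conjunct2[OF act[OF that(1)]]] that(2) by simp
  have act_twin: "N u = N u'" if "v \<in> A" "E v u" "E v u'" for u u' v
    using conjunct1[OF conjunct2[OF conjunct2[OF act[OF that(1)]]], rule_format, of u u'] that(2,3)
    by (simp only: N_iff)
  have act_block: "v \<in> \<Union>\<B>" if "v \<in> A" for v
    using conjunct2[OF conjunct2[OF conjunct2[OF act[OF that]]]] .
  define \<C> where "\<C> = {C \<in> \<B>. C \<inter> A \<noteq> {}}"
  have CB: "\<C> \<subseteq> \<B>" and CU: "\<C> \<subseteq> U" using BU by (auto simp: \<C>_def)
  \<comment> \<open>An active vertex of \<open>C\<close> is the choice in \<open>C\<close> of some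
    linked transversal, and \<open>active_invariant\<close> carries activity over to
    \<open>S C\<close>.\<close>
  have SA: "S C \<in> A" if C: "C \<in> \<C>" for C
  proof -
    obtain a where a: "a \<in> C" "a \<in> A" "C \<in> \<B>" using C by (auto simp: \<C>_def)
    obtain S' T' D where l: "linked \<B> S T S' T'" and D: "D \<in> \<B>" "a = S' D"
      using a(2) unfolding A_def by (rule activeE)
    obtain X' where c': "config \<B> X' S' T'" using linked_config[OF l c] by blast
    have "a \<in> D" using transversal_in[OF weak_configD(5)[OF configD(1)[OF c']], of D] D BU by auto
    then have "D = C" using block_unique[of D C a] a D(1) BU by auto
    then show ?thesis using active_invariant[OF l a(3)] a(2) D by (simp add: A_def)
  qed
  have b: "weak_config \<B> X S T" by (rule configD(1)[OF c])
  have tS: "transversal U S" by (rule weak_configD(5)[OF b])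
  obtain p where p: "\<And>x. x \<in> X \<Longrightarrow> p x \<in> X \<and> E x (p x)" "inj_on p X" by (rule partner[OF c]) blast
  have SX: "S C \<in> X" if "C \<in> \<C>" for C using weak_configD(9)[OF b, of C] that CB by auto
  have pX: "p (S C) \<in> X" "E (S C) (p (S C))" "E (p (S C)) (S C)" if "C \<in> \<C>" for C
    using p(1)[OF SX[OF that]] sym by auto
  have pA: "p (S C) \<in> A" if "C \<in> \<C>" for C using act_nbr[OF SA[OF that] pX(2)[OF that]] .
  define L where "L C = N (p (S C))" for C
  define R where "R C = N (S C)" for C
  have disj: "N x \<inter> N y = {}" if "x \<in> X" "y \<in> X" "x \<noteq> y" for x y
    using configD(9)[OF c that(1,2)] that(3) sym by (metis N_iff disjoint_iff)
  have crd: "card (L C) = d \<and> card (R C) = d \<and> L C \<inter> R C = {}" if "C \<in> \<C>" for C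
  proof (intro conjI)
    show "card (L C) = d" unfolding L_def by (rule configD(8)[OF c pX(1)[OF that]])
    show "card (R C) = d" unfolding R_def by (rule configD(8)[OF c SX[OF that]])
    have "p (S C) \<noteq> S C" using pX(2)[OF that] irrefl by metis
    then show "L C \<inter> R C = {}" unfolding L_def R_def by (rule disj[OF pX(1)[OF that] SX[OF that]])
  qed
  have NL: "N u = R C" if "C \<in> \<C>" "u \<in> L C" for C u
    using act_twin[OF pA[OF that(1)] _ pX(3)[OF that(1)], of u] that(2) by (simp add: L_def R_def)
  have NR: "N u = L C" if "C \<in> \<C>" "u \<in> R C" for C u
    using act_twin[OF SA[OF that(1)] _ pX(2)[OF that(1)], of u] that(2) by (simp add: L_def R_def)
  have inj: "inj_on S \<C>" by (rule inj_transversal[OF c tS CB])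
  have dj: "(L B \<union> R B) \<inter> (L C \<union> R C) = {}" if BC: "B \<in> \<C>" "C \<in> \<C>" "B \<noteq> C" for B C
  proof -
    have 1: "S B \<noteq> S C" using inj BC by (auto dest: inj_onD)
    then have 2: "p (S B) \<noteq> p (S C)" using inj_onD[OF p(2), of "S B" "S C"] SX BC by auto
    have 3: "S B \<noteq> p (S C)" "S C \<noteq> p (S B)"
      using transversal_indep[OF tS, of C B] transversal_indep[OF tS, of B C] pX(2)[OF BC(1)] pX(2)[OF BC(2)]
        subsetD[OF CU BC(1)] subsetD[OF CU BC(2)] by metis+
    have "N (p (S B)) \<inter> N (p (S C)) = {}" "N (p (S B)) \<inter> N (S C) = {}"
      "N (S B) \<inter> N (p (S C)) = {}" "N (S B) \<inter> N (S C) = {}"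
      by (intro disj SX pX(1) BC 1 2 3 3[symmetric])+
    then show ?thesis unfolding L_def R_def by auto
  qed
  have A: "A \<subseteq> \<Union>\<C>" using act_block by (auto simp: \<C>_def)
  have LA: "L C \<union> R C \<subseteq> A" if "C \<in> \<C>" for C
    using act_nbr[OF pA[OF that]] act_nbr[OF SA[OF that]] unfolding L_def R_def by auto
  have finC: "finite \<C>" by (rule finite_subset[OF CB configD(14)[OF c]])
  have finLR: "finite (L C \<union> R C)" for C using finite_N by (simp add: L_def R_def)
  \<comment> \<open>The sets \<open>L C \<union> R C\<close> are disjoint, have \<open>2 * d\<close>
    elements each and lie in \<open>\<Union>\<C>\<close>. The blocks of a configuration have exactly
    \<open>2 * d\<close> elements, so nothing in \<open>\<Union>\<C>\<close> is left over.\<close>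
  have "card (\<Union>C\<in>\<C>. L C \<union> R C) = (\<Sum>C\<in>\<C>. card (L C \<union> R C))"
    by (rule card_UN_disjoint[OF finC]) (use finLR dj in auto)
  also have "\<dots> = (\<Sum>C\<in>\<C>. 2 * d)"
  proof (rule sum.cong[OF refl])
    fix C assume C: "C \<in> \<C>"
    have "finite (L C)" "finite (R C)" using finLR[of C] by auto
    then show "card (L C \<union> R C) = 2 * d" using crd[OF C] by (simp add: card_Un_disjoint)
  qed
  also have "\<dots> = (\<Sum>C\<in>\<C>. card C)" using configD(10)[OF c] CB by (intro sum.cong) auto
  also have "\<dots> = card (\<Union>\<C>)" using card_Union_blocks[OF CU] by simp
  finally have "card (\<Union>C\<in>\<C>. L C \<union> R C) = card (\<Union>\<C>)" .
  moreover have "(\<Union>C\<in>\<C>. L C \<union> R C) \<subseteq> \<Union>\<C>" by (rule UN_least[OF subset_trans[OF LA A]])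
  ultimately have eq: "(\<Union>C\<in>\<C>. L C \<union> R C) = \<Union>\<C>" by (intro card_subset_eq[OF finite_Union_blocks[OF CU]])
  have "\<exists>C\<in>U. S C \<noteq> T C"
  proof (rule ccontr)
    assume "\<not> ?thesis"
    then have "conn S T" by (intro conn_cong) simp
    then show False using weak_configD(7)[OF b] by simp
  qed
  then obtain C where C: "C \<in> U" "S C \<noteq> T C" by auto
  then have "C \<in> \<B>" using weak_configD(8)[OF b, of C] by auto
  then have "S C \<in> A" "S C \<in> C" "C \<in> \<B>"
    using activeI[OF linked.start[of \<B> S T], of C] transversal_in[OF tS C(1)] C(2) by (simp_all add: A_def)
  then have "\<C> \<noteq> {}" by (auto simp: \<C>_def)
  then show ?thesis by (rule that[OF CU _ crd NL NR dj eq[symmetric]])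
qed

section \<open>Existence of a transversal\<close>

text \<open>Blocks are added one at a time, with the new block \<open>B\<close> as target of
  \<open>haxell_swap\<close>. Domination would let \<open>2 * card Q\<close> vertices cover
  \<open>card Q + 1\<close> blocks, which the thickness forbids unless \<open>d = 0\<close>; then
  there are no edges, and nothing is dominated.\<close>

theorem transversal_exists: "\<exists>f. transversal U f"
proof -
  have "\<exists>f. transversal P f" if "finite P" "P \<subseteq> U" for P
    using that
  proof (induction P rule: finite_induct)
    case empty
    then show ?case by (auto simp: transversal_def)
  next
    case (insert B P)
    then obtain f where f: "transversal P f" by auto
    obtain g where g: "(step P {})\<^sup>*\<^sup>* f g"
      and alt: "free_vertex P {} {B} g \<or> (\<exists>Q\<subseteq>P. \<exists>W. dominated {} {B} g Q W)"
      using haxell_swap[OF insert.hyps(1) f, of "{}" "{B}"] by (metis empty_iff)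
    have tg: "transversal P g" using steps_transversal[OF g f] .
    have "\<not> dominated {} {B} g Q W" if Q: "Q \<subseteq> P" for Q W
    proof
      assume dm: "dominated {} {B} g Q W"
      have fin: "finite Q" "B \<notin> Q" and QU: "insert B Q \<subseteq> U"
        using Q insert.hyps insert.prems finite_subset by auto
      have finW: "finite (W \<union> g ` Q)" using dm fin by (simp add: dominated_def)
      have dom: "\<exists>x\<in>W \<union> g ` Q. E u x" if "u \<in> \<Union>(insert B Q)" for u
        using dm that unfolding dominated_def by simp
      have "2 * d * card (insert B Q) \<le> card (\<Union>(insert B Q))" by (rule card_Union_blocks_ge[OF QU])
      also have "\<dots> \<le> card (\<Union>x\<in>W \<union> g ` Q. N x)"
      proof (rule card_mono)
        show "finite (\<Union>x\<in>W \<union> g ` Q. N x)" using finW finite_N by blast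
        show "\<Union>(insert B Q) \<subseteq> (\<Union>x\<in>W \<union> g ` Q. N x)"
        proof
          fix u assume "u \<in> \<Union>(insert B Q)"
          then show "u \<in> (\<Union>x\<in>W \<union> g ` Q. N x)" using dom[of u] sym by auto
        qed
      qed
      also have "\<dots> \<le> d * card (W \<union> g ` Q)" by (rule card_UN_N_le[OF finW])
      also have "card (W \<union> g ` Q) \<le> 2 * card Q"
        using card_Un_le[of W "g ` Q"] dm card_image_le[OF fin(1), of g] unfolding dominated_def by linarith
      finally have "d = 0" using fin by (simp add: algebra_simps)
      obtain u where "u \<in> B" using block_nonempty[of B] QU by blast
      then obtain x where "E u x" using dom[of u] by auto
      then have "N u \<noteq> {}" by auto
      then show False using card_N[of u] finite_N[of u] \<open>d = 0\<close> by simp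
    qed
    then obtain w where w: "w \<in> B" "\<And>C. C \<in> P \<Longrightarrow> \<not> E w (g C)" using alt by (auto simp: free_vertex_def)
    have "transversal (insert B P) (g(B := w))"
    proof (rule transversalI)
      fix C assume "C \<in> insert B P"
      then show "(g(B := w)) C \<in> C" using w(1) transversal_in[OF tg, of C] by auto
    next
      fix C D assume "C \<in> insert B P" "D \<in> insert B P"
      then show "\<not> E ((g(B := w)) C) ((g(B := w)) D)"
        using w(2)[of C] w(2)[of D] transversal_indep[OF tg, of C D] irrefl[of w] sym[of "g C" w] by auto
    qed
    then show ?case by blast
  qed
  then show ?thesis using finite_U by blast
qed

end

subsection \<open>Back to graph-partition pairs\<close>

lemma graph_partition_block_system:
  assumes gp: "graph_partition G \<U>" and md: "max_degree G = \<Delta>" and th: "thick (2 * \<Delta>) \<U>"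
  shows "block_system (\<lambda>x y. (x, y) \<in> parcs G) \<U> \<Delta>"
proof -
  interpret pair_graph G using gp by (simp add: graph_partition_def)
  have part: "partition_on (pverts G) \<U>" using gp by (simp add: graph_partition_def)
  have fin: "finite (\<Union>\<U>)" using pair_finite_verts partition_onD1[OF part] by simp
  show ?thesis
  proof
    show "(y, x) \<in> parcs G" if "(x, y) \<in> parcs G" for x y
      using that arcs_symmetric[of x y] by simp
    show "(x, x) \<notin> parcs G" for x using pair_no_loops[of "(x, x)"] by auto
    show "finite \<U>" using fin by (rule finite_UnionD)
    show "finite C" if "C \<in> \<U>" for C using fin that by (meson Union_upper finite_subset)
    show "C \<noteq> {}" if "C \<in> \<U>" for C using partition_onD3[OF part] that by auto
    show "B = C" if "B \<in> \<U>" "C \<in> \<U>" "x \<in> B" "x \<in> C" for B C x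
      using partition_onD2[OF part] that by (auto simp: disjoint_def)
    show "2 * \<Delta> \<le> card C" if "C \<in> \<U>" for C using th that by (simp add: thick_def)
    show "finite {y. (x, y) \<in> parcs G}" for x
      using pair_finite_verts by (rule rev_finite_subset) (auto dest: in_arcsD2)
    show "card {y. (x, y) \<in> parcs G} \<le> \<Delta>" for x
    proof (cases "x \<in> pverts G")
      case True
      have "{e \<in> parcs G. fst e = x} = Pair x ` {y. (x, y) \<in> parcs G}" by auto
      then have "card {y. (x, y) \<in> parcs G} = out_degree (with_proj G) x"
        by (simp add: out_degree_def out_arcs_def card_image inj_on_def)
      also have "\<dots> \<le> \<Delta>"
        unfolding md[symmetric] max_degree_def using True pair_finite_verts by (intro Max_ge) auto
      finally show ?thesis .
    next
      case False
      then have "{y. (x, y) \<in> parcs G} = {}" by (auto dest: in_arcsD1)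
      then show ?thesis by simp
    qed
  qed
qed

text \<open>If \<open>\<C>\<close> were a proper subfamily, closedness and symmetry would exclude
  arcs between \<open>\<Union>\<C>\<close> and the other blocks. The induced subgraphs on both parts
  would then decompose the pair.\<close>

lemma irreducible_closed:
  assumes gp: "graph_partition G \<U>" and irr: "irreducible_pair G \<U>"
    and C: "\<C> \<subseteq> \<U>" "\<C> \<noteq> {}" and closed: "\<And>x y. x \<in> \<Union>\<C> \<Longrightarrow> (x, y) \<in> parcs G \<Longrightarrow> y \<in> \<Union>\<C>"
  shows "\<C> = \<U>"
proof (rule ccontr)
  assume ne: "\<C> \<noteq> \<U>"
  interpret pair_graph G using gp by (simp add: graph_partition_def)
  have part: "partition_on (pverts G) \<U>" using gp by (simp add: graph_partition_def)
  have sym: "(y, x) \<in> parcs G" if "(x, y) \<in> parcs G" for x y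
    using that arcs_symmetric[of x y] by simp
  define H where "H \<D> = \<lparr>pverts = \<Union>\<D>, parcs = parcs G \<inter> \<Union>\<D> \<times> \<Union>\<D>\<rparr>" for \<D> :: "'a set set"
  have HP: "graph_partition (H \<D>) \<D>" if D: "\<D> \<subseteq> \<U>" for \<D>
  proof -
    have sub: "\<Union>\<D> \<subseteq> pverts G" using D partition_onD1[OF part] by auto
    have "pair_graph (H \<D>)"
    proof
      show "finite (pverts (H \<D>))" using finite_subset[OF sub pair_finite_verts] by (simp add: H_def)
      show "finite (parcs (H \<D>))" using pair_finite_arcs by (simp add: H_def)
      show "symmetric (with_proj (H \<D>))" using sym by (auto simp: symmetric_def H_def intro!: symI)
    qed (auto simp: H_def dest: pair_no_loops)
    moreover have "partition_on (\<Union>\<D>) \<D>"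
      using partition_onD2[OF part] partition_onD3[OF part] D
      by (intro partition_onI) (auto simp: disjoint_def pairwise_def disjnt_def)
    ultimately show ?thesis by (simp add: graph_partition_def H_def)
  qed
  have disj: "\<Union>\<C> \<inter> \<Union>(\<U> - \<C>) = {}" using partition_onD2[OF part] C(1) by (fastforce simp: disjoint_def)
  have V: "pverts G = \<Union>\<C> \<union> \<Union>(\<U> - \<C>)" using partition_onD1[OF part] C(1) by auto
  have arcs: "parcs G = parcs (H \<C>) \<union> parcs (H (\<U> - \<C>))"
  proof
    show "parcs G \<subseteq> parcs (H \<C>) \<union> parcs (H (\<U> - \<C>))"
    proof
      fix e assume e: "e \<in> parcs G"
      obtain x y where xy: "e = (x, y)" by (cases e)
      have "x \<in> pverts G" "y \<in> pverts G" using e xy by (auto dest: in_arcsD1 in_arcsD2)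
      then show "e \<in> parcs (H \<C>) \<union> parcs (H (\<U> - \<C>))"
        using closed[of x y] closed[of y x] sym[of x y] e xy V by (auto simp: H_def)
    qed
  qed (auto simp: H_def)
  have "is_union_of_pairs G \<U> (H \<C>) \<C> (H (\<U> - \<C>)) (\<U> - \<C>)"
    unfolding is_union_of_pairs_def using disj V arcs C(1) by (auto simp: H_def)
  moreover have "\<U> - \<C> \<noteq> {}" using C(1) ne by auto
  ultimately show False
    using irr C HP[OF C(1)] HP[of "\<U> - \<C>"] unfolding irreducible_pair_def by blast
qed

text \<open>The copies in \<open>disjoint_union_of_K\<close> are numbered by naturals, so the index
  set is enumerated by a bijection.\<close>

lemma disjoint_union_of_KI:
  fixes G :: "'a pair_pre_digraph"
  assumes fin: "finite I"
    and LR: "\<And>i. i \<in> I \<Longrightarrow> finite (L i) \<and> finite (R i) \<and> card (L i) = d \<and> card (R i) = d \<and> L i \<inter> R i = {}"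
    and disj: "\<And>i j. i \<in> I \<Longrightarrow> j \<in> I \<Longrightarrow> i \<noteq> j \<Longrightarrow> (L i \<union> R i) \<inter> (L j \<union> R j) = {}"
    and V: "pverts G = (\<Union>i\<in>I. L i \<union> R i)"
    and arcs: "parcs G = (\<Union>i\<in>I. L i \<times> R i \<union> R i \<times> L i)"
  shows "disjoint_union_of_K (card I) d G"
proof -
  obtain h where h: "bij_betw h {..<card I} I" using ex_bij_betw_nat_finite[OF fin] by (auto simp: lessThan_atLeast0)
  have hI: "h i \<in> I" if "i < card I" for i using h that by (auto simp: bij_betw_def)
  have im: "I = h ` {..<card I}" using h by (simp add: bij_betw_def)
  define H where "H i = \<lparr>pverts = L (h i) \<union> R (h i), parcs = L (h i) \<times> R (h i) \<union> R (h i) \<times> L (h i)\<rparr>" for i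
  have "complete_bipartite_digraph d d (with_proj (H i))" if "i < card I" for i
    unfolding complete_bipartite_digraph_pair_def using LR[OF hI[OF that]] by (auto simp: H_def)
  moreover have "is_disjoint_union G {..<card I} H"
    unfolding is_disjoint_union_def
  proof (intro conjI)
    show "disjoint_family_on (\<lambda>i. pverts (H i)) {..<card I}"
      unfolding disjoint_family_on_def
    proof (intro ballI impI)
      fix i j assume ij: "i \<in> {..<card I}" "j \<in> {..<card I}" "i \<noteq> j"
      then have "h i \<noteq> h j" using h by (auto simp: bij_betw_def dest: inj_onD)
      then show "pverts (H i) \<inter> pverts (H j) = {}" using disj[of "h i" "h j"] hI ij by (simp add: H_def)
    qed
    show "pverts G = (\<Union>i<card I. pverts (H i))" unfolding V by (subst im) (simp add: H_def)
    show "parcs G = (\<Union>i<card I. parcs (H i))" unfolding arcs by (subst im) (simp add: H_def)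
  qed
  ultimately show ?thesis unfolding disjoint_union_of_K_def by blast
qed

section \<open>Transversals as vertices of the reconfigurability graph\<close>

context
  fixes G :: "'a pair_pre_digraph" and \<U> :: "'a set set" and \<Delta> :: nat
  assumes gp: "graph_partition G \<U>" and bs: "block_system (\<lambda>x y. (x, y) \<in> parcs G) \<U> \<Delta>"
begin

interpretation block_system "\<lambda>x y. (x, y) \<in> parcs G" \<U> \<Delta> by (fact bs)

lemma verts_eq: "pverts G = \<Union>\<U>"
  using gp by (simp add: graph_partition_def partition_on_def)

lemma transversal_image_Int:
  assumes "transversal \<U> f" "B \<in> \<U>" shows "f ` \<U> \<inter> B = {f B}"
  using transversal_in[OF assms(1)] block_unique assms(2) by blast

lemma transversal_IT: "transversal \<U> f \<Longrightarrow> f ` \<U> \<in> IT G \<U>"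
  unfolding IT_def independent_set_def
  using transversal_image_Int transversal_in transversal_indep verts_eq by fastforce

lemma IT_transversal:
  assumes "S \<in> IT G \<U>" obtains f where "transversal \<U> f" "S = f ` \<U>"
proof -
  have S: "S \<subseteq> \<Union>\<U>" "\<And>u v. u \<in> S \<Longrightarrow> v \<in> S \<Longrightarrow> (u, v) \<notin> parcs G"
    and one: "\<And>B. B \<in> \<U> \<Longrightarrow> card (S \<inter> B) = 1"
    using assms verts_eq by (auto simp: IT_def independent_set_def)
  define f where "f B = the_elem (S \<inter> B)" for B
  have f: "S \<inter> B = {f B}" if "B \<in> \<U>" for B
    using one[OF that] unfolding f_def by (metis card_1_singletonE the_elem_eq)
  have "transversal \<U> f" using f S(2) by (intro transversalI) blast+
  moreover have "S = f ` \<U>" using f S(1) by blast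
  ultimately show ?thesis using that by blast
qed

text \<open>Distinct images rule out the trivial move. The new vertex then lies outside the old
  transversal, and the union has \<open>card \<U> + 1\<close> elements.\<close>

lemma step_arc:
  assumes "step \<U> {} f g" "f ` \<U> \<noteq> g ` \<U>"
  shows "(f ` \<U>, g ` \<U>) \<in> parcs (reconfigurability_graph G \<U>)"
proof -
  obtain C w where C: "C \<in> \<U>" "g = f(C := w)" "(f C, w) \<notin> parcs G"
    and t: "transversal \<U> f" "transversal \<U> g"
    using assms(1) by (auto simp: step_def)
  have wC: "w \<in> C" using transversal_in[OF t(2) C(1)] C(2) by simp
  have un: "f ` \<U> \<union> g ` \<U> = insert w (f ` \<U>)"
    using C by (auto simp: fun_upd_def)
  have wf: "w \<notin> f ` \<U>"
  proof
    assume "w \<in> f ` \<U>"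
    then have "w = f C" using transversal_image_Int[OF t(1) C(1)] wC by auto
    then show False using assms(2) C(2) by simp
  qed
  have "card (f ` \<U>) = card \<U>"
    using transversal_in[OF t(1)] block_unique by (intro card_image inj_onI) metis
  then have crd: "card (f ` \<U> \<union> g ` \<U>) = card \<U> + 1" unfolding un using wf finite_U by simp
  have wn: "(w, f B) \<notin> parcs G" if "B \<in> \<U>" for B
  proof (cases "B = C")
    case True then show ?thesis using C(3) sym by blast
  next
    case False then show ?thesis using transversal_indep[OF t(2) C(1) that] C(2) by simp
  qed
  have "independent_set G (insert w (f ` \<U>))"
    unfolding independent_set_def
    using wn sym irrefl transversal_in[OF t(1)] transversal_indep[OF t(1)] wC C(1) verts_eq by auto
  then show ?thesis
    using crd un transversal_IT[OF t(1)] transversal_IT[OF t(2)] by (simp add: reconfigurability_graph_def)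
qed

lemma conn_reachable:
  assumes t: "transversal \<U> f" and c: "conn f g"
  shows "(f ` \<U>) \<rightarrow>\<^sup>*\<^bsub>with_proj (reconfigurability_graph G \<U>)\<^esub> (g ` \<U>)"
proof -
  interpret R: pair_wf_digraph "reconfigurability_graph G \<U>"
    by unfold_locales (auto simp: reconfigurability_graph_def)
  show ?thesis
    using c unfolding conn_def
  proof (induction rule: rtranclp_induct)
    case base
    then show ?case using transversal_IT[OF t] by (intro R.reachable_refl) (simp add: reconfigurability_graph_def)
  next
    case (step Y Z)
    obtain f' g' where st: "block_graph.step (\<lambda>x y. (x, y) \<in> parcs G) \<U> {} f' g'" and YZ: "Y = f' ` \<U>" "Z = g' ` \<U>"
      using step.hyps(2) unfolding link_def by auto
    show ?case
    proof (cases "Y = Z")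
      case True then show ?thesis using step.IH by simp
    next
      case False
      then have "(Y, Z) \<in> parcs (reconfigurability_graph G \<U>)" using step_arc[OF st] YZ by simp
      then show ?thesis using step.IH R.reachable_adj_trans by simp
    qed
  qed
qed

lemma reconfigurability_connectedI:
  assumes "\<And>f g. transversal \<U> f \<Longrightarrow> transversal \<U> g \<Longrightarrow> conn f g"
  shows "Digraph_Component.connected (with_proj (reconfigurability_graph G \<U>))"
proof -
  interpret R: pair_wf_digraph "reconfigurability_graph G \<U>"
    by unfold_locales (auto simp: reconfigurability_graph_def)
  have verts: "pverts (reconfigurability_graph G \<U>) = IT G \<U>" by (simp add: reconfigurability_graph_def)
  show ?thesis
    unfolding connected_def
  proof (rule strongly_connectedI)
    \<comment> \<open>Connectedness of a digraph includes having a vertex, which is where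
      \<open>transversal_exists\<close> enters.\<close>
    show "verts (with_proj (mk_symmetric (with_proj (reconfigurability_graph G \<U>)))) \<noteq> {}"
      using transversal_exists transversal_IT verts by auto
    fix S T assume "S \<in> verts (with_proj (mk_symmetric (with_proj (reconfigurability_graph G \<U>))))"
      "T \<in> verts (with_proj (mk_symmetric (with_proj (reconfigurability_graph G \<U>))))"
    then have "S \<in> IT G \<U>" "T \<in> IT G \<U>" using verts by simp_all
    then obtain f g where f: "transversal \<U> f" "S = f ` \<U>" and g: "transversal \<U> g" "T = g ` \<U>"
      using IT_transversal by metis
    have "S \<rightarrow>\<^sup>*\<^bsub>with_proj (reconfigurability_graph G \<U>)\<^esub> T"
      using conn_reachable[OF f(1) assms[OF f(1) g(1)]] f g by simp
    then show "S \<rightarrow>\<^sup>*\<^bsub>with_proj (mk_symmetric (with_proj (reconfigurability_graph G \<U>)))\<^esub> T"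
      by (rule R.reachable_mk_symmetricI)
  qed
qed

text \<open>By \<open>disconnected_structure\<close> the arcs starting in
  \<open>\<Union>\<C>\<close> stay inside the bipartite pieces, so \<open>\<Union>\<C>\<close> is
  closed. Irreducibility makes \<open>\<C>\<close> the whole of \<open>\<U>\<close>, with one piece
  for each block.\<close>

lemma disconnected_union_of_K:
  assumes irr: "irreducible_pair G \<U>"
    and f: "transversal \<U> f" "transversal \<U> g" "\<not> conn f g"
  shows "disjoint_union_of_K (card \<U>) \<Delta> G"
proof -
  obtain \<C> L R where C: "\<C> \<subseteq> \<U>" "\<C> \<noteq> {}"
    and LR: "\<And>C. C \<in> \<C> \<Longrightarrow> card (L C) = \<Delta> \<and> card (R C) = \<Delta> \<and> L C \<inter> R C = {}"
    and NL: "\<And>C u. C \<in> \<C> \<Longrightarrow> u \<in> L C \<Longrightarrow> N u = R C"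
    and NR: "\<And>C u. C \<in> \<C> \<Longrightarrow> u \<in> R C \<Longrightarrow> N u = L C"
    and disj: "\<And>B C. B \<in> \<C> \<Longrightarrow> C \<in> \<C> \<Longrightarrow> B \<noteq> C \<Longrightarrow> (L B \<union> R B) \<inter> (L C \<union> R C) = {}"
    and un: "\<Union>\<C> = (\<Union>C\<in>\<C>. L C \<union> R C)"
    by (rule disconnected_structure[OF f]) blast
  have arc: "\<exists>C\<in>\<C>. (x, y) \<in> L C \<times> R C \<union> R C \<times> L C" if xy: "x \<in> \<Union>\<C>" "(x, y) \<in> parcs G" for x y
  proof -
    obtain C where "C \<in> \<C>" "x \<in> L C \<union> R C" using xy(1) unfolding un by auto
    moreover have "y \<in> N x" using xy(2) by simp
    ultimately show ?thesis using NL[of C x] NR[of C x] by blast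
  qed
  have "\<C> = \<U>"
  proof (rule irreducible_closed[OF gp irr C])
    show "y \<in> \<Union>\<C>" if "x \<in> \<Union>\<C>" "(x, y) \<in> parcs G" for x y
      using arc[OF that] un by auto
  qed
  interpret pair_graph G using gp by (simp add: graph_partition_def)
  show ?thesis
  proof (rule disjoint_union_of_KI[OF finite_U])
    fix C assume "C \<in> \<U>"
    then have C: "C \<in> \<C>" using \<open>\<C> = \<U>\<close> by simp
    then have "L C \<subseteq> \<Union>\<U>" "R C \<subseteq> \<Union>\<U>" using un \<open>\<C> = \<U>\<close> by auto
    then have "finite (L C)" "finite (R C)" using finite_Union_blocks[of \<U>] finite_subset by auto
    then show "finite (L C) \<and> finite (R C) \<and> card (L C) = \<Delta> \<and> card (R C) = \<Delta> \<and> L C \<inter> R C = {}"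
      using LR[OF C] by simp
  next
    show "(L B \<union> R B) \<inter> (L C \<union> R C) = {}" if "B \<in> \<U>" "C \<in> \<U>" "B \<noteq> C" for B C
      using disj that \<open>\<C> = \<U>\<close> by simp
    show "pverts G = (\<Union>C\<in>\<U>. L C \<union> R C)" using un verts_eq \<open>\<C> = \<U>\<close> by simp
    show "parcs G = (\<Union>C\<in>\<U>. L C \<times> R C \<union> R C \<times> L C)"
    proof
      show "parcs G \<subseteq> (\<Union>C\<in>\<U>. L C \<times> R C \<union> R C \<times> L C)"
      proof
        fix e assume e: "e \<in> parcs G"
        obtain x y where xy: "e = (x, y)" by (cases e)
        then have "x \<in> \<Union>\<C>" using e in_arcsD1[of x y] verts_eq \<open>\<C> = \<U>\<close> by simp
        then show "e \<in> (\<Union>C\<in>\<U>. L C \<times> R C \<union> R C \<times> L C)" using arc[of x y] e xy \<open>\<C> = \<U>\<close> by simp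
      qed
      show "(\<Union>C\<in>\<U>. L C \<times> R C \<union> R C \<times> L C) \<subseteq> parcs G"
      proof
        fix e assume "e \<in> (\<Union>C\<in>\<U>. L C \<times> R C \<union> R C \<times> L C)"
        then obtain C x y where C: "C \<in> \<C>" "e = (x, y)" "x \<in> L C \<and> y \<in> R C \<or> x \<in> R C \<and> y \<in> L C"
          using \<open>\<C> = \<U>\<close> by blast
        then have "y \<in> N x" using NL[of C x] NR[of C x] by blast
        then show "e \<in> parcs G" using C(2) by simp
      qed
    qed
  qed
qed

end

theorem theorem1p2:
  fixes G :: "'a pair_pre_digraph" and \<U> :: "'a set set" and \<Delta> :: nat
  assumes "graph_partition G \<U>"
    and "max_degree G = \<Delta>"
    and "thick (2 * \<Delta>) \<U>"
    and "irreducible_pair G \<U>"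
    and "\<not> disjoint_union_of_K (card \<U>) \<Delta> G"
  shows "Digraph_Component.connected (with_proj (reconfigurability_graph G \<U>))"
proof -
  have bs: "block_system (\<lambda>x y. (x, y) \<in> parcs G) \<U> \<Delta>"
    by (rule graph_partition_block_system[OF assms(1-3)])
  show ?thesis
    using reconfigurability_connectedI[OF assms(1) bs] disconnected_union_of_K[OF assms(1) bs assms(4)] assms(5)
    by blast
qed

end
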